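(* Let $\mu_0,\mu_1$ be as in the context, and let $\varepsilon>0$ be small enough such that $\sup_{x\in\Omega_0}|\mathcal{S}_{x,\varepsilon}|\le\frac13|\Omega_1|$. There is exactly one $x\in(a_0,b_0)$ with $y_M(x)=b_1$ and $\xi(x,y_M(x))=0$, denoted $x^{(M)}$, and exactly one $x\in(a_0,b_0)$ with $y_m(x)=a_1$ and $\xi(x,y_m(x))=0$, denoted $x^{(m)}$. The interval-valued map $x\mapsto\mathcal{S}_{x,\varepsilon}=[y_m(x),y_M(x)]$ is increasing in the sense that $x\mapsto y_m(x)$ and $x\mapsto y_M(x)$ are increasing (i.e. nondecreasing) on $\Omega_0$. More precisely, $y_m(x)=a_1$ for $x\in[a_0,x^{(m)}]$, whereas $x\mapsto y_m(x)$ is strictly increasing on $(x^{(m)},b_0]$ with derivative $$y_m'(x)=-\frac{y_m(x)-f_\varepsilon'(x)}{x-g_\varepsilon'(y_m(x))}.$$ Similarly, $y_M(x)=b_1$ for $x\in[x^{(M)},b_0]$, whereas $x\mapsto y_M(x)$ is strictly increasing on $[a_0,x^{(M)})$ with derivative $$y_M'(x)=-\frac{y_M(x)-f_\varepsilon'(x)}{x-g_\varepsilon'(y_M(x))}>0.$$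
   Context: Standing assumption: for $i=0,1$, $\mu_i$ is a probability measure on $\mathbb{R}$ supported on a compact interval $\Omega_i=[a_i,b_i]$, with a continuous density $u_i\in\mathcal{C}(\Omega_i)$ (i.e. $d\mu_i=u_i\,dx$) satisfying $0<\lambda\le u_i\le\Lambda<\infty$ on $\Omega_i$ for constants $\lambda,\Lambda$. For $\varepsilon>0$, let $\pi_\varepsilon$ be the unique minimizer over couplings $\pi\in\Pi(\mu_0,\mu_1)$ of $\int\frac12(x-y)^2\,d\pi+\frac{\varepsilon}{2}\int\big(\frac{d\pi}{d(\mu_0\otimes\mu_1)}\big)^2d(\mu_0\otimes\mu_1)$. The potentials $(f_\varepsilon,g_\varepsilon)$ are continuous functions $f_\varepsilon:\Omega_0\to\mathbb{R}$, $g_\varepsilon:\Omega_1\to\mathbb{R}$ with $\frac{d\pi_\varepsilon}{d(\mu_0\otimes\mu_1)}(x,y)=\big(\frac{xy-f_\varepsilon(x)-g_\varepsilon(y)}{\varepsilon}\big)_+$, where $(a)_+=\max(a,0)$; equivalently they satisfy $\int(xy-f_\varepsilon(x)-g_\varepsilon(y))_+\,d\mu_1(y)=\varepsilon$ for all $x\in\Omega_0$ and $\int(xy-f_\varepsilon(x)-g_\varepsilon(y))_+\,d\mu_0(x)=\varepsilon$ for all $y\in\Omega_1$. They exist and are unique up to replacing $(f_\varepsilon,g_\varepsilon)$ by $(f_\varepsilon+\alpha,g_\varepsilon-\alpha)$, $\alpha\in\mathbb{R}$. Both $f_\varepsilon$ and $g_\varepsilon$ are convex and continuously differentiable on $\Omega_0$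 and $\Omega_1$ respectively (one-sided derivatives at endpoints). Notation: $\xi(x,y):=xy-f_\varepsilon(x)-g_\varepsilon(y)$; $\mathcal{S}_{x,\varepsilon}:=\{y\in\Omega_1:\xi(x,y)\ge0\}$, which is a compact interval written $[y_m(x),y_M(x)]$; $|B|$ denotes the Lebesgue measure of $B$. *)

theory Defs
  imports "HOL-Probability.Probability"
begin

definition marginal_with_density ::
  "real \<Rightarrow> real \<Rightarrow> (real \<Rightarrow> real) \<Rightarrow> real \<Rightarrow> real \<Rightarrow> real measure \<Rightarrow> bool" where
  "marginal_with_density a b u l L \<mu> \<longleftrightarrow>
     prob_space \<mu> \<and>
     \<mu> = density lborel (\<lambda>x. ennreal (u x) * indicator {a..b} x) \<and>
     continuous_on {a..b} u \<and>
     (\<forall>x\<in>{a..b}. l \<le> u x \<and> u x \<le> L)"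

definition couplings :: "real measure \<Rightarrow> real measure \<Rightarrow> (real \<times> real) measure set" where
  "couplings \<mu>0 \<mu>1 =
     {\<pi>. sets \<pi> = sets borel \<and> distr \<pi> borel fst = \<mu>0 \<and> distr \<pi> borel snd = \<mu>1}"

text \<open>The quadratically regularized transport functional; as usual, it is infinite on couplings
  that are not absolutely continuous with respect to the product measure.\<close>

definition qot_cost ::
  "real \<Rightarrow> real measure \<Rightarrow> real measure \<Rightarrow> (real \<times> real) measure \<Rightarrow> ennreal" where
  "qot_cost \<epsilon> \<mu>0 \<mu>1 \<pi> =
     (if absolutely_continuous (\<mu>0 \<Otimes>\<^sub>M \<mu>1) \<pi>
      then (\<integral>\<^sup>+ z. ennreal ((fst z - snd z)\<^sup>2 / 2) \<partial>\<pi>)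
         + ennreal (\<epsilon> / 2) * (\<integral>\<^sup>+ z. (RN_deriv (\<mu>0 \<Otimes>\<^sub>M \<mu>1) \<pi> z)\<^sup>2 \<partial>(\<mu>0 \<Otimes>\<^sub>M \<mu>1))
      else \<infinity>)"

definition qot_minimizer ::
  "real \<Rightarrow> real measure \<Rightarrow> real measure \<Rightarrow> (real \<times> real) measure \<Rightarrow> bool" where
  "qot_minimizer \<epsilon> \<mu>0 \<mu>1 \<pi> \<longleftrightarrow>
     \<pi> \<in> couplings \<mu>0 \<mu>1 \<and>
     (\<forall>\<pi>'\<in>couplings \<mu>0 \<mu>1. qot_cost \<epsilon> \<mu>0 \<mu>1 \<pi> \<le> qot_cost \<epsilon> \<mu>0 \<mu>1 \<pi>')"

definition xi :: "(real \<Rightarrow> real) \<Rightarrow> (real \<Rightarrow> real) \<Rightarrow> real \<Rightarrow> real \<Rightarrow> real" where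
  "xi f g x y = x * y - f x - g y"

text \<open>The potentials live on the supporting intervals; the values of \<^term>\<open>f\<close> and \<^term>\<open>g\<close>
  outside these intervals are irrelevant.\<close>

definition qot_potentials ::
  "real \<Rightarrow> real set \<Rightarrow> real set \<Rightarrow> real measure \<Rightarrow> real measure \<Rightarrow> (real \<times> real) measure
     \<Rightarrow> (real \<Rightarrow> real) \<Rightarrow> (real \<Rightarrow> real) \<Rightarrow> bool" where
  "qot_potentials \<epsilon> \<Omega>0 \<Omega>1 \<mu>0 \<mu>1 \<pi> f g \<longleftrightarrow>
     continuous_on \<Omega>0 f \<and> continuous_on \<Omega>1 g \<and>
     absolutely_continuous (\<mu>0 \<Otimes>\<^sub>M \<mu>1) \<pi> \<and>
     (AE z in \<mu>0 \<Otimes>\<^sub>M \<mu>1.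
        RN_deriv (\<mu>0 \<Otimes>\<^sub>M \<mu>1) \<pi> z = ennreal (max (xi f g (fst z) (snd z) / \<epsilon>) 0))"

definition section_at ::
  "(real \<Rightarrow> real) \<Rightarrow> (real \<Rightarrow> real) \<Rightarrow> real set \<Rightarrow> real \<Rightarrow> real set" where
  "section_at f g \<Omega>1 x = {y \<in> \<Omega>1. xi f g x y \<ge> 0}"

definition y_m :: "(real \<Rightarrow> real) \<Rightarrow> (real \<Rightarrow> real) \<Rightarrow> real set \<Rightarrow> real \<Rightarrow> real" where
  "y_m f g \<Omega>1 x = Inf (section_at f g \<Omega>1 x)"

definition y_M :: "(real \<Rightarrow> real) \<Rightarrow> (real \<Rightarrow> real) \<Rightarrow> real set \<Rightarrow> real \<Rightarrow> real" where
  "y_M f g \<Omega>1 x = Sup (section_at f g \<Omega>1 x)"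

definition is_x_M ::
  "(real \<Rightarrow> real) \<Rightarrow> (real \<Rightarrow> real) \<Rightarrow> real \<Rightarrow> real \<Rightarrow> real \<Rightarrow> real \<Rightarrow> real \<Rightarrow> bool" where
  "is_x_M f g a0 b0 a1 b1 x \<longleftrightarrow>
     x \<in> {a0<..<b0} \<and> y_M f g {a1..b1} x = b1 \<and> xi f g x (y_M f g {a1..b1} x) = 0"

definition is_x_m ::
  "(real \<Rightarrow> real) \<Rightarrow> (real \<Rightarrow> real) \<Rightarrow> real \<Rightarrow> real \<Rightarrow> real \<Rightarrow> real \<Rightarrow> real \<Rightarrow> bool" where
  "is_x_m f g a0 b0 a1 b1 x \<longleftrightarrow>
     x \<in> {a0<..<b0} \<and> y_m f g {a1..b1} x = a1 \<and> xi f g x (y_m f g {a1..b1} x) = 0"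

end

theory Submission
  imports Defs
begin

text \<open>
  Write \<open>\<xi>(x, y) = x * y - f x - g y\<close>. That the plan with density \<open>\<xi>\<^sub>+ / \<epsilon>\<close> has the prescribed
  marginals means that \<open>\<xi>(x, \<cdot>)\<^sub>+\<close> has integral \<open>\<epsilon>\<close> for almost all, hence by continuity for all,
  \<open>x\<close>, and likewise with the variables exchanged (\<open>dual_pair_of_potentials\<close>). Everything else
  follows from these two families of equations.

  \<^item> Subtracting the equations at \<open>x\<close> and \<open>x'\<close> and using that the positive part is convex, one finds
    that the barycenter of \<open>{y. \<xi>(x, y) > 0}\<close> is a subgradient of \<open>f\<close> at \<open>x\<close>
    (\<open>barycenter_subgradient\<close>). So \<open>f\<close>, and by symmetry \<open>g\<close>, is convex, the functions \<open>\<xi>(x, \<cdot>)\<close>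
    and \<open>\<xi>(\<cdot>, y)\<close> are concave, and the sections are intervals. A concave function with positive
    values has at most two zeros, so the barycenter depends continuously on \<open>x\<close> by dominated convergence
    and is the derivative of \<open>f\<close>.

  \<^item> For \<open>x < x'\<close> the difference \<open>\<xi>(x', y) - \<xi>(x, y)\<close> is strictly increasing in \<open>y\<close>, whereas the
    positive parts have the same integral. So the difference is negative to the left of the section at \<open>x\<close>
    (\<open>xi_decreases_left_of_section\<close>), and the lower endpoints increase, strictly so once they
    have left \<open>a1\<close>.

  \<^item> If no section is the whole target interval, monotonicity forces \<open>\<xi>(a0, a1) \<ge> 0 > \<xi>(b0, a1)\<close>.
    Together with concavity this gives exactly one interior zero of \<open>\<xi>(\<cdot>, a1)\<close>, at which the sections
    leave the point \<open>a1\<close> (\<open>ex1_x_m\<close>, \<open>sign_around_x_m\<close>).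

  \<^item> To the right of that zero the lower endpoint \<open>y\<close> solves \<open>\<xi>(x, y) = 0\<close>, depends continuously on \<open>x\<close>, and
    \<open>\<partial>\<xi>/\<partial>y = x - g'(y)\<close> is positive by concavity; implicit differentiation gives the formula
    (\<open>lower_has_derivative\<close>). The derivative is positive because the barycenter \<open>f'(x)\<close> lies
    strictly above the lower endpoint.

  The reflection \<open>(x, y) \<mapsto> (- x, - y)\<close> turns the results on lower endpoints into those on upper
  endpoints.
\<close>

section \<open>Subgradients and measures with full support on an interval\<close>

text \<open>A function with a subgradient at every point is the supremum of its affine minorants, hence
  convex.\<close>

lemma convex_on_subgradient:
  fixes f m :: "real \<Rightarrow> real"
  assumes "convex S"
    and sub: "\<And>x x'. x \<in> S \<Longrightarrow> x' \<in> S \<Longrightarrow> m x * (x' - x) \<le> f x' - f x"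
  shows "convex_on S f"
  unfolding convex_on_def
proof (intro conjI ballI allI impI)
  fix x y u v :: real
  assume xy: "x \<in> S" "y \<in> S" and uv: "0 \<le> u" "0 \<le> v" "u + v = 1"
  define z where "z = u *\<^sub>R x + v *\<^sub>R y"
  have z: "z \<in> S"
    using \<open>convex S\<close> xy uv unfolding z_def by (rule convexD)
  have "u * (m z * (x - z)) + v * (m z * (y - z)) \<le> u * (f x - f z) + v * (f y - f z)"
    using sub[OF z xy(1)] sub[OF z xy(2)] uv by (intro add_mono mult_left_mono) auto
  also have "\<dots> = u * f x + v * f y - (u + v) * f z"
    by (simp add: algebra_simps)
  also have "u * (m z * (x - z)) + v * (m z * (y - z)) = m z * (u *\<^sub>R x + v *\<^sub>R y - (u + v) * z)"
    by (simp add: algebra_simps)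
  finally show "f (u *\<^sub>R x + v *\<^sub>R y) \<le> u * f x + v * f y"
    using uv(3) by (simp add: z_def)
qed fact

text \<open>The subgradient inequalities at \<^term>\<open>x\<close> and at \<^term>\<open>x'\<close> squeeze the difference
  quotient between \<^term>\<open>m x\<close> and \<^term>\<open>m x'\<close>, whatever the sign of \<^term>\<open>x' - x\<close>; so continuity
  of \<^term>\<open>m\<close> gives the derivative, one-sided at boundary points of \<^term>\<open>S\<close>.\<close>

lemma has_real_derivative_continuous_subgradient:
  fixes f m :: "real \<Rightarrow> real"
  assumes sub: "\<And>x x'. x \<in> S \<Longrightarrow> x' \<in> S \<Longrightarrow> m x * (x' - x) \<le> f x' - f x"
    and cont: "continuous_on S m" and x: "x \<in> S"
  shows "(f has_real_derivative m x) (at x within S)"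
  unfolding has_field_derivative_iff
proof (rule LIM_zero_cancel, rule Lim_transform_bound)
  show "((\<lambda>x'. m x' - m x) \<longlongrightarrow> 0) (at x within S)"
    using cont x by (auto simp: continuous_on_def LIM_zero_iff)
  have *: "\<bar>(f x' - f x) / (x' - x) - m x\<bar> \<le> \<bar>m x' - m x\<bar>" if x': "x' \<in> S" "x' \<noteq> x" for x'
  proof -
    have lo: "m x * (x' - x) \<le> f x' - f x" and up: "f x' - f x \<le> m x' * (x' - x)"
      using sub[OF x x'(1)] sub[OF x'(1) x] by (auto simp: algebra_simps)
    show ?thesis
    proof (cases "x < x'")
      case True
      then have "m x \<le> (f x' - f x) / (x' - x)" "(f x' - f x) / (x' - x) \<le> m x'"
        using lo up by (auto simp: field_simps)
      then show ?thesis by linarith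
    next
      case False
      then have "(f x' - f x) / (x' - x) \<le> m x" "m x' \<le> (f x' - f x) / (x' - x)"
        using lo up x'(2) by (auto simp: field_simps)
      then show ?thesis by linarith
    qed
  qed
  show "\<forall>\<^sub>F x' in at x within S. norm ((f x' - f x) / (x' - x) - m x) \<le> norm (m x' - m x)"
    unfolding eventually_at_filter using * by (auto intro!: always_eventually)
qed

text \<open>All that is used of a marginal: it does not charge points and charges every subinterval of
  its supporting interval. Unlike a density, this description is stable under reflection.\<close>

locale full_interval_measure = finite_measure \<mu> for \<mu> :: "real measure" +
  fixes a b :: real
  assumes sets_eq [measurable_cong, simp]: "sets \<mu> = sets borel"
    and atomless: "\<And>y. emeasure \<mu> {y} = 0"
    and full: "\<And>c d. a \<le> c \<Longrightarrow> c < d \<Longrightarrow> d \<le> b \<Longrightarrow> 0 < measure \<mu> {c<..<d}"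
    and nondegenerate: "a < b"
begin

lemma open_interval_near:
  assumes "p \<in> {a..b}" "0 < \<delta>"
  obtains c d where "a \<le> c" "c < d" "d \<le> b" "{c<..<d} \<subseteq> {a..b} \<inter> ball p \<delta>"
proof
  define c where "c = max a (p - \<delta>)"
  define d where "d = min b (p + \<delta>)"
  show "a \<le> c" "c < d" "d \<le> b" "{c<..<d} \<subseteq> {a..b} \<inter> ball p \<delta>"
    using assms nondegenerate by (auto simp: c_def d_def dist_real_def)
qed

lemma AE_continuous_imp_everywhere:
  fixes h :: "real \<Rightarrow> real"
  assumes cont: "continuous_on {a..b} h"
    and ae: "AE y in \<mu>. y \<in> {a..b} \<longrightarrow> h y = c" and p: "p \<in> {a..b}"
  shows "h p = c"
proof (rule ccontr)
  assume "h p \<noteq> c"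
  then have "0 < \<bar>h p - c\<bar>" by simp
  then obtain \<delta> where \<delta>: "\<delta> > 0" "\<And>y. y \<in> {a..b} \<Longrightarrow> dist y p < \<delta> \<Longrightarrow> dist (h y) (h p) < \<bar>h p - c\<bar>"
    using cont p unfolding continuous_on_iff by metis
  obtain s t where st: "a \<le> s" "s < t" "t \<le> b" "{s<..<t} \<subseteq> {a..b} \<inter> ball p \<delta>"
    using open_interval_near[OF p \<delta>(1)] .
  have "AE y in \<mu>. y \<notin> {s<..<t}"
    using ae
  proof eventually_elim
    case (elim y)
    show ?case
    proof
      assume "y \<in> {s<..<t}"
      then have "y \<in> {a..b}" "dist y p < \<delta>" using st(4) by (auto simp: dist_commute)
      then show False using \<delta>(2)[of y] elim by (auto simp: dist_real_def)
    qed
  qed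
  then have "measure \<mu> {s<..<t} = 0"
    by (simp add: AE_iff_null null_sets_def measure_def sets_eq_imp_space_eq[OF sets_eq]
        greaterThanLessThan_eq Collect_conj_eq greaterThan_def lessThan_def)
  then show False using full[OF st(1-3)] by simp
qed

lemma set_integrable_continuous:
  fixes h :: "real \<Rightarrow> real"
  assumes "continuous_on {a..b} h"
  shows "set_integrable \<mu> {a..b} h"
proof -
  have "bounded (h ` {a..b})"
    using assms by (intro compact_imp_bounded compact_continuous_image) auto
  then obtain B where B: "\<And>y. y \<in> {a..b} \<Longrightarrow> norm (h y) \<le> B"
    unfolding bounded_iff by blast
  have "norm (h a) \<le> B" using B nondegenerate by auto
  then have "0 \<le> B" by (metis norm_ge_zero order_trans)
  show ?thesis unfolding set_integrable_def
  proof (rule integrable_const_bound[of _ B])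
    show "AE y in \<mu>. norm (indicat_real {a..b} y *\<^sub>R h y) \<le> B"
      using B \<open>0 \<le> B\<close> by (auto simp: indicator_def)
    show "(\<lambda>y. indicat_real {a..b} y *\<^sub>R h y) \<in> borel_measurable \<mu>"
      using borel_measurable_continuous_on_indicator[OF _ assms]
      by (simp add: measurable_cong_sets[OF sets_eq refl])
  qed
qed

lemma set_integral_strict_mono:
  fixes h k :: "real \<Rightarrow> real"
  assumes h: "continuous_on {a..b} h" and k: "continuous_on {a..b} k"
    and le: "\<And>y. y \<in> {a..b} \<Longrightarrow> h y \<le> k y"
    and p: "p \<in> {a..b}" "h p < k p"
  shows "(LINT y:{a..b}|\<mu>. h y) < (LINT y:{a..b}|\<mu>. k y)"
proof (rule ccontr)
  note int = set_integrable_continuous[OF h] set_integrable_continuous[OF k]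
  define w where "w y = indicat_real {a..b} y * (k y - h y)" for y
  assume "\<not> ?thesis"
  moreover have "(LINT y:{a..b}|\<mu>. k y - h y) = (LINT y:{a..b}|\<mu>. k y) - (LINT y:{a..b}|\<mu>. h y)"
    using int by (intro set_integral_diff)
  ultimately have "integral\<^sup>L \<mu> w \<le> 0" by (simp add: set_lebesgue_integral_def w_def[abs_def])
  moreover have w0: "0 \<le> w y" for y using le by (auto simp: w_def indicator_def)
  moreover have "0 \<le> integral\<^sup>L \<mu> w" using w0 by simp
  moreover have wi: "integrable \<mu> w"
    using set_integral_diff(1)[OF int(2,1)] by (simp add: set_integrable_def w_def[abs_def])
  ultimately have "AE y in \<mu>. w y = 0"
    using integral_nonneg_eq_0_iff_AE[OF wi] by auto
  then have "AE y in \<mu>. y \<in> {a..b} \<longrightarrow> k y - h y = 0"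
    by eventually_elim (auto simp: w_def)
  then have "k p - h p = 0"
    by (intro AE_continuous_imp_everywhere[OF _ _ p(1)] continuous_intros h k)
  then show False using p by simp
qed

end

section \<open>One marginal constraint: monotone sections and convex potentials\<close>

lemma xi_swap: "xi g f y x = xi f g x y"
  by (simp add: xi_def)

text \<open>One of the two marginal equations, here for the first variable. Exchanging the two variables
  turns it into the other one, and every lemma about \<^term>\<open>f\<close> proved in this locale yields one
  about \<^term>\<open>g\<close>.\<close>

locale marginal_constraint = full_interval_measure \<mu> a1 b1
  for \<mu> :: "real measure" and a1 b1 :: real +
  fixes a0 b0 \<epsilon> :: real and f g :: "real \<Rightarrow> real"
  assumes domain_nondegenerate: "a0 < b0"
    and \<epsilon>_pos: "0 < \<epsilon>"
    and cont_f: "continuous_on {a0..b0} f"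
    and cont_g: "continuous_on {a1..b1} g"
    and constraint: "\<And>x. x \<in> {a0..b0} \<Longrightarrow> (LINT y:{a1..b1}|\<mu>. max (xi f g x y) 0) = \<epsilon>"
begin

abbreviation lower :: "real \<Rightarrow> real" where
  "lower \<equiv> y_m f g {a1..b1}"

lemma cont_xi_snd: "continuous_on {a1..b1} (xi f g x)"
  unfolding xi_def[abs_def] by (intro continuous_intros cont_g)

lemma cont_xi_fst: "continuous_on {a0..b0} (\<lambda>x. xi f g x y)"
  unfolding xi_def[abs_def] by (intro continuous_intros cont_f)

lemma AE_neq: "AE y in \<mu>. y \<noteq> c"
  using atomless[of c]
  by (auto simp: AE_iff_null null_sets_def sets_eq_imp_space_eq[OF sets_eq])

lemma xi_pos_not_null:
  assumes "x \<in> {a0..b0}"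
  shows "\<not> (AE y in \<mu>. y \<in> {a1..b1} \<longrightarrow> xi f g x y \<le> 0)"
proof
  assume "AE y in \<mu>. y \<in> {a1..b1} \<longrightarrow> xi f g x y \<le> 0"
  then have "AE y in \<mu>. indicat_real {a1..b1} y *\<^sub>R max (xi f g x y) 0 = 0"
    by eventually_elim (auto simp: indicator_def)
  then have "(LINT y:{a1..b1}|\<mu>. max (xi f g x y) 0) = 0"
    unfolding set_lebesgue_integral_def by (rule integral_eq_zero_AE)
  then show False using constraint[OF assms] \<epsilon>_pos by simp
qed

text \<open>Because the measure has no atoms, a point where \<^term>\<open>xi f g x\<close> is positive can be chosen
  different from any prescribed point. This is what makes inequalities strict later on.\<close>

lemma xi_pos_somewhere:
  assumes "x \<in> {a0..b0}"
  obtains p where "p \<in> {a1..b1}" "p \<noteq> c" "0 < xi f g x p"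
proof (rule ccontr)
  assume no: "\<not> thesis"
  have "AE y in \<mu>. y \<in> {a1..b1} \<longrightarrow> xi f g x y \<le> 0"
    using AE_neq[of c] by eventually_elim (metis no that not_less)
  then show False using xi_pos_not_null[OF assms] by simp
qed

lemma section_closed: "closed (section_at f g {a1..b1} x)"
proof -
  have "closed ({a1..b1} \<inter> xi f g x -` {0..})"
    by (intro continuous_closed_preimage cont_xi_snd) auto
  also have "{a1..b1} \<inter> xi f g x -` {0..} = section_at f g {a1..b1} x"
    by (auto simp: section_at_def)
  finally show ?thesis .
qed

lemma section_nonempty:
  assumes "x \<in> {a0..b0}"
  shows "section_at f g {a1..b1} x \<noteq> {}"
  by (rule xi_pos_somewhere[OF assms]) (auto simp: section_at_def)

lemma lower_in_section:
  assumes "x \<in> {a0..b0}"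
  shows "lower x \<in> section_at f g {a1..b1} x"
  unfolding y_m_def
proof (rule closed_contains_Inf[OF section_nonempty[OF assms] _ section_closed])
  show "bdd_below (section_at f g {a1..b1} x)"
    by (rule bdd_belowI[of _ a1]) (auto simp: section_at_def)
qed

lemma lower_le:
  assumes "y \<in> {a1..b1}" "0 \<le> xi f g x y"
  shows "lower x \<le> y"
  unfolding y_m_def
  by (rule cInf_lower) (use assms in \<open>auto simp: section_at_def intro: bdd_belowI[of _ a1]\<close>)

lemma lower_bounds:
  assumes "x \<in> {a0..b0}"
  shows "lower x \<in> {a1..b1}" "0 \<le> xi f g x (lower x)"
  using lower_in_section[OF assms] by (auto simp: section_at_def)

lemma lower_eq_left_iff:
  assumes "x \<in> {a0..b0}"
  shows "lower x = a1 \<longleftrightarrow> 0 \<le> xi f g x a1"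
  using lower_le[of a1 x] lower_bounds[OF assms] nondegenerate by auto

lemma xi_lower_eq_0:
  assumes x: "x \<in> {a0..b0}" and gt: "a1 < lower x"
  shows "xi f g x (lower x) = 0"
proof (rule ccontr)
  let ?l = "lower x"
  assume "xi f g x ?l \<noteq> 0"
  then have pos: "0 < xi f g x ?l" using lower_bounds[OF x] by simp
  then obtain \<delta> where \<delta>: "\<delta> > 0"
    "\<And>y. y \<in> {a1..b1} \<Longrightarrow> dist y ?l < \<delta> \<Longrightarrow> dist (xi f g x y) (xi f g x ?l) < xi f g x ?l"
    using cont_xi_snd[of x] lower_bounds(1)[OF x] unfolding continuous_on_iff by metis
  define y where "y = max a1 (?l - \<delta> / 2)"
  have y: "y \<in> {a1..b1}" "y < ?l" "dist y ?l < \<delta>"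
    using gt \<delta>(1) lower_bounds(1)[OF x] by (auto simp: y_def dist_real_def)
  then have "0 \<le> xi f g x y" using \<delta>(2)[OF y(1,3)] by (auto simp: dist_real_def)
  then show False using lower_le[OF y(1), of x] y(2) by simp
qed

text \<open>The single-crossing argument behind all monotonicity: \<^term>\<open>xi f g x' y - xi f g x y\<close> is
  strictly increasing in \<^term>\<open>y\<close>, with slope \<^term>\<open>x' - x\<close>. If it were nonnegative at some point to the
  left of the section at \<^term>\<open>x\<close>, it would be positive on the section beyond that point, and the integral of the
  positive part would be larger at \<^term>\<open>x'\<close> than at \<^term>\<open>x\<close>; but both equal \<^term>\<open>\<epsilon>\<close>.\<close>

lemma xi_decreases_left_of_section:
  assumes x: "x \<in> {a0..b0}" "x' \<in> {a0..b0}" "x < x'" and y: "y \<le> lower x"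
  shows "xi f g x' y < xi f g x y"
proof (rule ccontr)
  assume "\<not> ?thesis"
  then have cross: "xi f g x y \<le> xi f g x' y" by simp
  have gt: "xi f g x z < xi f g x' z" if "y < z" for z
  proof -
    have "0 < (x' - x) * (z - y)" using x that by simp
    then show ?thesis using cross by (simp add: xi_def algebra_simps)
  qed
  have le: "max (xi f g x z) 0 \<le> max (xi f g x' z) 0" if "z \<in> {a1..b1}" for z
  proof (cases "0 < xi f g x z")
    case True
    then have "y \<le> z" using lower_le[OF that, of x] y by simp
    then show ?thesis using gt[of z] cross by (cases "y = z") auto
  qed auto
  obtain p where p: "p \<in> {a1..b1}" "p \<noteq> y" "0 < xi f g x p"
    using xi_pos_somewhere[OF x(1)] .
  then have "y < p" using lower_le[of p x] y by simp
  then have "max (xi f g x p) 0 < max (xi f g x' p) 0" using gt[of p] p by simp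
  then have "(LINT y:{a1..b1}|\<mu>. max (xi f g x y) 0) < (LINT y:{a1..b1}|\<mu>. max (xi f g x' y) 0)"
    by (intro set_integral_strict_mono[OF _ _ le p(1)] continuous_intros cont_xi_snd)
  then show False using constraint[OF x(1)] constraint[OF x(2)] by simp
qed

lemma lower_mono: "mono_on {a0..b0} lower"
proof (rule mono_onI, rule ccontr)
  fix x x'
  assume x: "x \<in> {a0..b0}" "x' \<in> {a0..b0}" "x \<le> x'" and not: "\<not> lower x \<le> lower x'"
  then have "x < x'" by (cases "x = x'") auto
  moreover have "xi f g x (lower x') < 0"
    using lower_le[OF lower_bounds(1)[OF x(2)], of x] not by force
  ultimately show False
    using xi_decreases_left_of_section[OF x(1,2), of "lower x'"] lower_bounds(2)[OF x(2)] not by simp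
qed

lemma lower_strict:
  assumes x: "x \<in> {a0..b0}" "x' \<in> {a0..b0}" "x < x'" and gt: "a1 < lower x"
  shows "lower x < lower x'"
proof -
  have "lower x \<noteq> lower x'"
    using xi_decreases_left_of_section[OF x, of "lower x"] xi_lower_eq_0[OF x(1) gt]
      lower_bounds(2)[OF x(2)] by auto
  then show ?thesis using mono_onD[OF lower_mono x(1,2)] x(3) by simp
qed

text \<open>The section without the zeros of \<^term>\<open>xi f g x\<close>. Measurability and positive mass are immediate
  for it, and the two sets differ by a null set.\<close>

definition pos_set :: "real \<Rightarrow> real set" where
  "pos_set x = {y \<in> {a1..b1}. 0 < xi f g x y}"

definition barycenter :: "real \<Rightarrow> real" where
  "barycenter x = (LINT y:pos_set x|\<mu>. y) / measure \<mu> (pos_set x)"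

lemma sets_pos_set [measurable, simp]: "pos_set x \<in> sets borel"
proof -
  have "(\<lambda>y. indicat_real {a1..b1} y *\<^sub>R xi f g x y) \<in> borel_measurable borel"
    by (intro borel_measurable_continuous_on_indicator cont_xi_snd) auto
  then have meas: "{y \<in> space borel. 0 < indicat_real {a1..b1} y *\<^sub>R xi f g x y} \<in> sets borel"
    by measurable
  have "pos_set x = {y \<in> space borel. 0 < indicat_real {a1..b1} y *\<^sub>R xi f g x y}"
    by (auto simp: pos_set_def indicator_def)
  with meas show ?thesis by (simp only:)
qed

lemma set_integrable_pos_set:
  assumes "continuous_on {a1..b1} h"
  shows "set_integrable \<mu> (pos_set x) (h :: real \<Rightarrow> real)"
  by (rule set_integrable_subset[OF set_integrable_continuous[OF assms]]) (simp, auto simp: pos_set_def)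

lemma measure_pos_set:
  assumes "x \<in> {a0..b0}"
  shows "0 < measure \<mu> (pos_set x)"
proof (rule ccontr)
  assume "\<not> ?thesis"
  then have "measure \<mu> (pos_set x) = 0" using measure_nonneg[of \<mu> "pos_set x"] by linarith
  then have "pos_set x \<in> null_sets \<mu>" by (auto simp: emeasure_eq_measure)
  then have "AE y in \<mu>. y \<notin> pos_set x" by (rule AE_not_in)
  then have "AE y in \<mu>. y \<in> {a1..b1} \<longrightarrow> xi f g x y \<le> 0"
    by eventually_elim (auto simp: pos_set_def)
  then show False using xi_pos_not_null[OF assms] by simp
qed

lemma set_integral_affine_pos_set:
  assumes "x \<in> {a0..b0}"
  shows "(LINT y:pos_set x|\<mu>. s * y - c) = (s * barycenter x - c) * measure \<mu> (pos_set x)"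
proof -
  have "(LINT y:pos_set x|\<mu>. s * y - c) = (LINT y:pos_set x|\<mu>. s * y) - (LINT y:pos_set x|\<mu>. c)"
    by (intro set_integral_diff set_integrable_pos_set continuous_intros)
  also have "(LINT y:pos_set x|\<mu>. c) = measure \<mu> (pos_set x) * c"
    by (subst set_integral_const) (auto simp: emeasure_eq_measure)
  also have "(LINT y:pos_set x|\<mu>. s * y) = s * barycenter x * measure \<mu> (pos_set x)"
    using measure_pos_set[OF assms] by (simp add: barycenter_def)
  finally show ?thesis by (simp add: algebra_simps)
qed

text \<open>Convexity of the positive part gives
  \<open>(xi f g x' y)\<^sub>+ - (xi f g x y)\<^sub>+ \<ge> (x' - x) * y - (f x' - f x)\<close> where \<^term>\<open>xi f g x y\<close> is positive,
  and the left side is nonnegative elsewhere. Its integral vanishes by the marginal constraint,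
  which leaves the subgradient inequality at the barycenter. Convexity of \<^term>\<open>f\<close> is thus a
  consequence of the constraint.\<close>

lemma barycenter_subgradient:
  assumes x: "x \<in> {a0..b0}" "x' \<in> {a0..b0}"
  shows "barycenter x * (x' - x) \<le> f x' - f x"
proof -
  let ?P = "pos_set x"
  let ?h = "\<lambda>x y. max (xi f g x y) 0"
  have cont: "continuous_on {a1..b1} (?h z)" for z
    by (intro continuous_intros cont_xi_snd)
  have "((x' - x) * barycenter x - (f x' - f x)) * measure \<mu> ?P
    = (LINT y:?P|\<mu>. (x' - x) * y - (f x' - f x))"
    by (rule set_integral_affine_pos_set[OF x(1), symmetric])
  also have "\<dots> \<le> (LINT y:{a1..b1}|\<mu>. ?h x' y - ?h x y)"
    unfolding set_lebesgue_integral_def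
  proof (rule integral_mono)
    show "integrable \<mu> (\<lambda>y. indicat_real ?P y *\<^sub>R ((x' - x) * y - (f x' - f x)))"
      using set_integrable_pos_set[of "\<lambda>y. (x' - x) * y - (f x' - f x)" x]
      unfolding set_integrable_def by (simp add: continuous_intros)
    show "integrable \<mu> (\<lambda>y. indicat_real {a1..b1} y *\<^sub>R (?h x' y - ?h x y))"
      using set_integral_diff(1)[OF set_integrable_continuous set_integrable_continuous, OF cont cont]
      unfolding set_integrable_def .
    show "indicat_real ?P y *\<^sub>R ((x' - x) * y - (f x' - f x))
        \<le> indicat_real {a1..b1} y *\<^sub>R (?h x' y - ?h x y)" for y
      by (auto simp: indicator_def pos_set_def xi_def algebra_simps)
  qed
  also have "\<dots> = (LINT y:{a1..b1}|\<mu>. ?h x' y) - (LINT y:{a1..b1}|\<mu>. ?h x y)"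
    by (intro set_integral_diff set_integrable_continuous cont)
  also have "\<dots> = 0" using constraint x by simp
  finally show ?thesis
    using measure_pos_set[OF x(1)] by (simp add: mult_le_0_iff mult.commute)
qed

lemma convex_f: "convex_on {a0..b0} f"
  by (rule convex_on_subgradient[of _ barycenter]) (auto intro: barycenter_subgradient)

text \<open>Strict, because the lower endpoint bounds the section from below but carries no mass.\<close>

lemma lower_less_barycenter:
  assumes x: "x \<in> {a0..b0}"
  shows "lower x < barycenter x"
proof (rule ccontr)
  let ?w = "\<lambda>y. indicat_real (pos_set x) y *\<^sub>R (1 * y - lower x)"
  assume "\<not> ?thesis"
  then have "(1 * barycenter x - lower x) * measure \<mu> (pos_set x) \<le> 0"
    using measure_pos_set[OF x] by (simp add: mult_le_0_iff)
  then have "integral\<^sup>L \<mu> ?w \<le> 0"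
    using set_integral_affine_pos_set[OF x, of 1 "lower x"] by (simp add: set_lebesgue_integral_def)
  moreover have w: "0 \<le> ?w y" for y
    using lower_le[of y x] by (auto simp: pos_set_def indicator_def)
  moreover have "0 \<le> integral\<^sup>L \<mu> ?w" using w by (intro integral_nonneg_AE) auto
  moreover have "integrable \<mu> ?w"
    using set_integrable_pos_set[of "\<lambda>y. 1 * y - lower x" x]
    unfolding set_integrable_def by (simp add: continuous_intros)
  ultimately have "AE y in \<mu>. ?w y = 0"
    using integral_nonneg_eq_0_iff_AE[of \<mu> ?w] by (simp only: antisym AE_I2 simp_thms)
  then have "AE y in \<mu>. y \<in> {a1..b1} \<longrightarrow> xi f g x y \<le> 0"
    using AE_neq[of "lower x"] by eventually_elim (auto simp: pos_set_def indicator_def split: if_splits)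
  then show False using xi_pos_not_null[OF x] by simp
qed

end

section \<open>Both constraints: continuity and differentiability\<close>

lemma concave_on_pos_between:
  fixes h :: "real \<Rightarrow> real"
  assumes h: "concave_on S h" and uv: "u \<in> S" "v \<in> S" "0 \<le> h u" "0 < h v"
    and z: "z \<in> closed_segment u v" "z \<noteq> u"
  shows "0 < h z"
proof -
  obtain t where t: "0 \<le> t" "t \<le> 1" "z = (1 - t) *\<^sub>R u + t *\<^sub>R v"
    using z(1) by (auto simp: in_segment)
  have "t \<noteq> 0" using z(2) t(3) by auto
  then have "0 < (1 - t) * h u + t * h v"
    using t uv by (intro add_nonneg_pos mult_nonneg_nonneg mult_pos_pos) auto
  also have "\<dots> \<le> h z"
    using concave_onD[OF h t(1,2) uv(1,2)] t(3) by simp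
  finally show ?thesis .
qed

text \<open>Implicit differentiation at points that may lie on the boundary of either interval, so that
  the implicit function theorem does not apply. The difference quotient of \<^term>\<open>g\<close> is extended
  continuously to the base point (Caratheodory's form \<open>G\<close> of the derivative), which avoids
  dividing by \<^term>\<open>y x' - y x\<close>.\<close>

lemma implicit_xi_derivative:
  fixes f g y :: "real \<Rightarrow> real"
  assumes f': "(f has_real_derivative f') (at x within S)"
    and g': "(g has_real_derivative g') (at (y x) within T)"
    and y: "(y \<longlongrightarrow> y x) (at x within S)"
    and zero: "\<forall>\<^sub>F x' in at x within S. y x' \<in> T \<and> xi f g x' (y x') = 0" "xi f g x (y x) = 0"
    and transversal: "x - g' \<noteq> 0"
  shows "(y has_real_derivative - ((y x - f') / (x - g'))) (at x within S)"
  unfolding has_field_derivative_iff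
proof (rule Lim_transform_eventually)
  define G where "G z = (if z = y x then g' else (g z - g (y x)) / (z - y x))" for z
  have G: "g z - g (y x) = G z * (z - y x)" for z by (simp add: G_def)
  have "continuous (at (y x) within T) G"
    unfolding continuous_within
  proof (rule Lim_transform_eventually)
    show "((\<lambda>z. (g z - g (y x)) / (z - y x)) \<longlongrightarrow> G (y x)) (at (y x) within T)"
      using g' by (simp add: has_field_derivative_iff G_def)
    show "\<forall>\<^sub>F z in at (y x) within T. (g z - g (y x)) / (z - y x) = G z"
      by (auto simp: eventually_at_filter G_def)
  qed
  then have "((\<lambda>x'. G (y x')) \<longlongrightarrow> G (y x)) (at x within S)"
    by (rule continuous_within_tendsto_compose) (use zero(1) y in \<open>auto elim: eventually_mono\<close>)
  then have lim: "((\<lambda>x'. x - G (y x')) \<longlongrightarrow> x - g') (at x within S)"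
    by (intro tendsto_intros) (simp add: G_def)
  have "((\<lambda>x'. ((f x' - f x) / (x' - x) - y x') / (x - G (y x'))) \<longlongrightarrow> (f' - y x) / (x - g'))
      (at x within S)"
    using f' by (intro tendsto_divide tendsto_diff y lim transversal) (simp add: has_field_derivative_iff)
  then show "((\<lambda>x'. ((f x' - f x) / (x' - x) - y x') / (x - G (y x'))) \<longlongrightarrow> - ((y x - f') / (x - g')))
      (at x within S)"
    by (simp add: minus_divide_left)
  have "\<forall>\<^sub>F x' in at x within S. x - G (y x') \<noteq> 0"
    using lim transversal by (rule tendsto_imp_eventually_ne)
  moreover have "\<forall>\<^sub>F x' in at x within S. x' \<noteq> x" by (simp add: eventually_at_filter)
  ultimately show "\<forall>\<^sub>F x' in at x within S.
      ((f x' - f x) / (x' - x) - y x') / (x - G (y x')) = (y x' - y x) / (x' - x)"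
    using zero(1)
  proof eventually_elim
    case (elim x')
    have "(x - G (y x')) * (y x' - y x) = f x' - f x - y x' * (x' - x)"
      using elim zero(2) G[of "y x'"] by (simp add: xi_def algebra_simps)
    moreover have "(f x' - f x) / (x' - x) - y x' = (f x' - f x - y x' * (x' - x)) / (x' - x)"
      using elim by (simp add: diff_divide_distrib)
    ultimately have "(f x' - f x) / (x' - x) - y x' = (x - G (y x')) * (y x' - y x) / (x' - x)"
      by simp
    then show ?case using elim by simp
  qed
qed

locale dual_pair =
  marginal_constraint \<mu>1 a1 b1 a0 b0 \<epsilon> f g + swap: marginal_constraint \<mu>0 a0 b0 a1 b1 \<epsilon> g f
  for \<mu>0 \<mu>1 a0 b0 a1 b1 \<epsilon> f g
begin

lemma concave_xi_snd: "concave_on {a1..b1} (xi f g x)"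
  unfolding concave_on_iff
proof (intro conjI ballI allI impI)
  fix y z u v :: real
  assume yz: "y \<in> {a1..b1}" "z \<in> {a1..b1}" and uv: "0 \<le> u" "0 \<le> v" "u + v = 1"
  have u: "u = 1 - v" using uv by simp
  have "g (u *\<^sub>R y + v *\<^sub>R z) \<le> u * g y + v * g z"
    using swap.convex_f yz uv unfolding convex_on_def by blast
  then show "u * xi f g x y + v * xi f g x z \<le> xi f g x (u *\<^sub>R y + v *\<^sub>R z)"
    unfolding xi_def u by (simp add: algebra_simps)
qed simp

lemma dual_pair_swap: "dual_pair \<mu>1 \<mu>0 a1 b1 a0 b0 \<epsilon> g f"
  by unfold_locales

lemma concave_xi_fst: "concave_on {a0..b0} (\<lambda>x. xi f g x y)"
proof -
  have "xi g f y = (\<lambda>x. xi f g x y)" by (rule ext) (rule xi_swap)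
  then show ?thesis using dual_pair.concave_xi_snd[OF dual_pair_swap, of y] by simp
qed

text \<open>Continuity of the lower endpoint: \<^term>\<open>xi f g x\<close> is positive slightly above it and,
  unless it equals \<^term>\<open>a1\<close>, negative slightly below it. These signs persist for nearby \<^term>\<open>x'\<close>, and by concavity they enclose the
  lower endpoint at \<^term>\<open>x'\<close>.\<close>

lemma lower_tendsto:
  assumes x: "x \<in> {a0..b0}"
  shows "(lower \<longlongrightarrow> lower x) (at x within {a0..b0})"
proof -
  obtain p where p: "p \<in> {a1..b1}" "p \<noteq> lower x" "0 < xi f g x p"
    using xi_pos_somewhere[OF x] .
  then have lp: "lower x < p" using lower_le[of p x] by simp
  have lim: "((\<lambda>x'. xi f g x' y) \<longlongrightarrow> xi f g x y) (at x within {a0..b0})" for y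
    using cont_xi_fst x by (auto simp: continuous_on_def)
  have "\<forall>\<^sub>F x' in at x within {a0..b0}. x' \<in> {a0..b0}"
    by (simp add: eventually_at_filter)
  then have ev: "\<forall>\<^sub>F x' in at x within {a0..b0}. x' \<in> {a0..b0} \<and> 0 < xi f g x' p"
    using order_tendstoD(1)[OF lim[of p] p(3)] by (rule eventually_conj)
  show ?thesis
  proof (rule order_tendstoI)
    fix c assume c: "c < lower x"
    show "\<forall>\<^sub>F x' in at x within {a0..b0}. c < lower x'"
    proof (cases "a1 \<le> c")
      case False
      show ?thesis using ev
        by eventually_elim (use False lower_bounds(1) in force)
    next
      case True
      then have c': "c \<in> {a1..b1}" using c lp p(1) by auto
      then have "xi f g x c < 0" using lower_le[of c x] c by force
      then have "\<forall>\<^sub>F x' in at x within {a0..b0}. xi f g x' c < 0"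
        by (rule order_tendstoD(2)[OF lim])
      with ev show ?thesis
      proof eventually_elim
        case (elim x')
        show ?case
        proof (rule ccontr)
          assume "\<not> c < lower x'"
          moreover have "lower x' \<noteq> c"
            using lower_bounds(2)[of x'] elim by auto
          ultimately have "0 < xi f g x' c"
            using elim lower_bounds[of x'] p(1) c lp
            by - (rule concave_on_pos_between[OF concave_xi_snd, of "lower x'" p],
              auto simp: closed_segment_eq_real_ivl)
          then show False using elim by simp
        qed
      qed
    qed
  next
    fix c assume c: "lower x < c"
    define q where "q = min p ((lower x + c) / 2)"
    have q: "lower x < q" "q \<le> p" "q < c" using c lp by (auto simp: q_def min_def)
    then have "0 < xi f g x q"
      using lower_bounds[OF x] p
      by - (rule concave_on_pos_between[OF concave_xi_snd, of "lower x" p],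
        auto simp: closed_segment_eq_real_ivl)
    then have "\<forall>\<^sub>F x' in at x within {a0..b0}. 0 < xi f g x' q"
      by (rule order_tendstoD(1)[OF lim])
    then show "\<forall>\<^sub>F x' in at x within {a0..b0}. lower x' < c"
    proof eventually_elim
      case (elim x')
      then have "lower x' \<le> q"
        using q p(1) lower_bounds(1)[OF x] by (intro lower_le) auto
      then show ?case using q by simp
    qed
  qed
qed

text \<open>A concave function that is positive at \<^term>\<open>p\<close> has at most one zero on either side of \<^term>\<open>p\<close>.\<close>

lemma AE_xi_neq_0:
  assumes x: "x \<in> {a0..b0}"
  shows "AE y in \<mu>1. y \<in> {a1..b1} \<longrightarrow> xi f g x y \<noteq> 0"
proof -
  obtain p where p: "p \<in> {a1..b1}" "0 < xi f g x p"
    using xi_pos_somewhere[OF x] .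
  define Z where "Z = {y \<in> {a1..b1}. xi f g x y = 0}"
  have only_one: "y = z"
    if "y \<in> Z" "z \<in> Z" "y < p \<longleftrightarrow> z < p" for y z
  proof (rule ccontr)
    assume "y \<noteq> z"
    then have "z \<in> closed_segment y p \<or> y \<in> closed_segment z p"
      using that(3) by (auto simp: closed_segment_eq_real_ivl)
    then show False
      using concave_on_pos_between[OF concave_xi_snd, of y p x z]
        concave_on_pos_between[OF concave_xi_snd, of z p x y] that(1,2) p \<open>y \<noteq> z\<close>
      by (auto simp: Z_def)
  qed
  have "inj_on (\<lambda>y. y < p) Z"
    using only_one by (auto simp: inj_on_def)
  then have "finite Z"
    by (rule inj_on_finite[of _ _ UNIV]) auto
  then have "AE y in \<mu>1. \<forall>z\<in>Z. y \<noteq> z"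
    by (simp add: AE_finite_all AE_neq)
  then show ?thesis by eventually_elim (auto simp: Z_def)
qed

text \<open>The indicators of the positivity sets converge wherever \<^term>\<open>xi f g x\<close> does not vanish, that is,
  almost everywhere, and dominated convergence applies.\<close>

lemma continuous_on_integral_pos_set:
  assumes h: "continuous_on {a1..b1} h"
  shows "continuous_on {a0..b0} (\<lambda>x. LINT y:pos_set x|\<mu>1. (h y :: real))"
proof (rule continuous_on_sequentiallyI)
  fix u x assume u: "\<forall>n. u n \<in> {a0..b0}" and x: "x \<in> {a0..b0}" and ux: "u \<longlonglongrightarrow> x"
  have meas: "(\<lambda>y. indicat_real (pos_set z) y *\<^sub>R h y) \<in> borel_measurable \<mu>1" for z
    using set_integrable_pos_set[OF h, of z] by (auto simp: set_integrable_def)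
  show "(\<lambda>n. LINT y:pos_set (u n)|\<mu>1. h y) \<longlonglongrightarrow> (LINT y:pos_set x|\<mu>1. h y)"
    unfolding set_lebesgue_integral_def
  proof (rule integral_dominated_convergence[where w = "\<lambda>y. \<bar>indicat_real {a1..b1} y *\<^sub>R h y\<bar>"])
    show "integrable \<mu>1 (\<lambda>y. \<bar>indicat_real {a1..b1} y *\<^sub>R h y\<bar>)"
      using set_integrable_continuous[OF h] unfolding set_integrable_def by (rule integrable_abs)
    show "AE y in \<mu>1. norm (indicat_real (pos_set (u n)) y *\<^sub>R h y) \<le> \<bar>indicat_real {a1..b1} y *\<^sub>R h y\<bar>" for n
      by (auto simp: indicator_def pos_set_def)
    show "AE y in \<mu>1. (\<lambda>n. indicat_real (pos_set (u n)) y *\<^sub>R h y) \<longlonglongrightarrow> indicat_real (pos_set x) y *\<^sub>R h y"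
      using AE_xi_neq_0[OF x]
    proof eventually_elim
      case (elim y)
      have lim: "(\<lambda>n. xi f g (u n) y) \<longlonglongrightarrow> xi f g x y"
        using continuous_on_tendsto_compose[OF cont_xi_fst ux x] u by simp
      have "\<forall>\<^sub>F n in sequentially. u n \<in> {a0..b0} \<and> (y \<in> pos_set (u n) \<longleftrightarrow> y \<in> pos_set x)"
      proof (cases "y \<in> {a1..b1}")
        case False
        then have "\<And>z. y \<notin> pos_set z" by (auto simp: pos_set_def)
          then show ?thesis using u by simp
      next
        case True
        then consider "0 < xi f g x y" | "xi f g x y < 0" using elim by force
        then show ?thesis
        proof cases
          case 1
          from order_tendstoD(1)[OF lim 1] show ?thesis
            by eventually_elim (use 1 True u in \<open>auto simp: pos_set_def\<close>)
        next
          case 2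
          from order_tendstoD(2)[OF lim 2] show ?thesis
            by eventually_elim (use 2 u in \<open>auto simp: pos_set_def\<close>)
        qed
      qed
      then have "\<forall>\<^sub>F n in sequentially. indicat_real (pos_set (u n)) y *\<^sub>R h y = indicat_real (pos_set x) y *\<^sub>R h y"
        by eventually_elim (auto simp: indicator_def)
      then show ?case by (rule tendsto_eventually)
    qed
  qed (use meas in auto)
qed

lemma continuous_on_barycenter: "continuous_on {a0..b0} barycenter"
proof -
  have "measure \<mu>1 (pos_set x) = (LINT y:pos_set x|\<mu>1. 1)" for x
    by (subst set_integral_const) (auto simp: emeasure_eq_measure)
  then have "continuous_on {a0..b0} (\<lambda>x. measure \<mu>1 (pos_set x))"
    by (simp only:) (intro continuous_on_integral_pos_set continuous_intros)
  then show ?thesis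
    unfolding barycenter_def[abs_def]
    by (intro continuous_on_divide continuous_on_integral_pos_set continuous_intros)
      (auto dest: measure_pos_set)
qed

lemma deriv_f:
  assumes "x \<in> {a0..b0}"
  shows "(f has_real_derivative barycenter x) (at x within {a0..b0})"
  using barycenter_subgradient continuous_on_barycenter assms
  by (rule has_real_derivative_continuous_subgradient)

lemma deriv_g:
  assumes "y \<in> {a1..b1}"
  shows "(g has_real_derivative swap.barycenter y) (at y within {a1..b1})"
  using dual_pair.deriv_f[OF dual_pair_swap assms] .

text \<open>The derivative of \<^term>\<open>xi f g x\<close> is positive at its lower zero, because a concave function
  that vanishes there and becomes positive to the right must leave zero with positive slope.\<close>

lemma lower_transversal:
  assumes x: "x \<in> {a0..b0}" and gt: "a1 < lower x"
  shows "swap.barycenter (lower x) < x"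
proof (rule ccontr)
  assume not: "\<not> ?thesis"
  obtain p where p: "p \<in> {a1..b1}" "0 < xi f g x p"
    using xi_pos_somewhere[OF x] .
  have lp: "lower x < p"
    using lower_le[of p x] p xi_lower_eq_0[OF assms] by (cases "p = lower x") auto
  have "0 < xi f g x p - xi f g x (lower x)"
    using p xi_lower_eq_0[OF assms] by simp
  also have "\<dots> = x * (p - lower x) - (g p - g (lower x))"
    by (simp add: xi_def algebra_simps)
  also have "\<dots> \<le> x * (p - lower x) - swap.barycenter (lower x) * (p - lower x)"
    using swap.barycenter_subgradient[OF lower_bounds(1)[OF x] p(1)] by simp
  also have "\<dots> = (x - swap.barycenter (lower x)) * (p - lower x)"
    by (simp add: algebra_simps)
  finally show False using not lp by (simp add: zero_less_mult_iff)
qed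

lemma lower_has_derivative:
  assumes x: "x \<in> {a0..b0}" and gt: "a1 < lower x"
  shows "\<exists>f' g'. (f has_real_derivative f') (at x within {a0..b0}) \<and>
    (g has_real_derivative g') (at (lower x) within {a1..b1}) \<and> x - g' \<noteq> 0 \<and>
    (lower has_real_derivative - ((lower x - f') / (x - g'))) (at x within {a0..b0}) \<and>
    0 < - ((lower x - f') / (x - g'))"
proof (intro exI conjI)
  show *: "(f has_real_derivative barycenter x) (at x within {a0..b0})"
    "(g has_real_derivative swap.barycenter (lower x)) (at (lower x) within {a1..b1})"
    "x - swap.barycenter (lower x) \<noteq> 0"
    using deriv_f[OF x] deriv_g[OF lower_bounds(1)[OF x]] lower_transversal[OF assms] by auto
  have "\<forall>\<^sub>F x' in at x within {a0..b0}. x' \<in> {a0..b0}"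
    by (simp add: eventually_at_filter)
  moreover have "\<forall>\<^sub>F x' in at x within {a0..b0}. a1 < lower x'"
    using lower_tendsto[OF x] gt by (rule order_tendstoD(1))
  ultimately have "\<forall>\<^sub>F x' in at x within {a0..b0}. lower x' \<in> {a1..b1} \<and> xi f g x' (lower x') = 0"
    by eventually_elim (use lower_bounds(1) xi_lower_eq_0 in blast)
  then show "(lower has_real_derivative - ((lower x - barycenter x) / (x - swap.barycenter (lower x))))
      (at x within {a0..b0})"
    by (intro implicit_xi_derivative[OF *(1,2) lower_tendsto[OF x] _ xi_lower_eq_0[OF assms] *(3)])
  show "0 < - ((lower x - barycenter x) / (x - swap.barycenter (lower x)))"
    using lower_less_barycenter[OF x] lower_transversal[OF assms] by (simp add: divide_less_0_iff)
qed

lemma section_contains_between: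
  assumes "u \<in> {a1..b1}" "v \<in> {a1..b1}" "0 \<le> xi f g x u" "0 \<le> xi f g x v" "y \<in> {u..v}"
  shows "y \<in> section_at f g {a1..b1} x"
proof -
  have "concave_on {u..v} (xi f g x)"
    unfolding concave_on_def
    by (rule convex_on_subset[OF concave_xi_snd[unfolded concave_on_def]]) (use assms in auto)
  then have "min (xi f g x u) (xi f g x v) \<le> xi f g x y"
    using assms(5) by (rule concave_on_ge_min)
  then show ?thesis using assms by (auto simp: section_at_def)
qed

lemma section_eq_Icc:
  assumes x: "x \<in> {a0..b0}"
  shows "section_at f g {a1..b1} x = {lower x..y_M f g {a1..b1} x}"
proof -
  let ?S = "section_at f g {a1..b1} x"
  have bdd: "bdd_above ?S"
    by (rule bdd_aboveI[of _ b1]) (auto simp: section_at_def)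
  have M: "y_M f g {a1..b1} x \<in> ?S"
    unfolding y_M_def by (rule closed_contains_Sup[OF section_nonempty[OF x] bdd section_closed])
  show ?thesis
  proof (intro set_eqI iffI)
    fix y assume "y \<in> ?S"
    then show "y \<in> {lower x..y_M f g {a1..b1} x}"
      using lower_le[of y x] cSup_upper[OF _ bdd, of y] by (auto simp: y_M_def section_at_def)
  next
    fix y assume "y \<in> {lower x..y_M f g {a1..b1} x}"
    then show "y \<in> ?S"
      using lower_bounds[OF x] M by (intro section_contains_between) (auto simp: section_at_def)
  qed
qed

end

section \<open>The lower endpoint when no section is full\<close>

text \<open>Smallness of \<^term>\<open>\<epsilon>\<close> enters only through the fact that no section is the whole target interval.
  In this form the hypothesis is invariant under reflection.\<close>

locale partial_sections = dual_pair \<mu>0 \<mu>1 a0 b0 a1 b1 \<epsilon> f g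
  for \<mu>0 \<mu>1 a0 b0 a1 b1 \<epsilon> f g +
  assumes not_full_section: "\<And>x. x \<in> {a0..b0} \<Longrightarrow> \<not> (0 \<le> xi f g x a1 \<and> 0 \<le> xi f g x b1)"
begin

text \<open>The bottom endpoint \<^term>\<open>a1\<close> of the target lies in some section, hence, the sections being
  increasing, in the one at \<^term>\<open>a0\<close>. If it also lay in the one at \<^term>\<open>b0\<close>, it would lie in all sections;
  but some section contains \<^term>\<open>b1\<close>, and that one would be full.\<close>

lemma lower_corner_signs: "0 \<le> xi f g a0 a1" "xi f g b0 a1 < 0"
proof -
  have ends: "a0 \<in> {a0..b0}" "b0 \<in> {a0..b0}" "a1 \<in> {a1..b1}" "b1 \<in> {a1..b1}"
    using domain_nondegenerate nondegenerate by auto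
  obtain x where x: "x \<in> {a0..b0}" "0 < xi f g x a1"
    using swap.xi_pos_somewhere[OF ends(3)] by (metis xi_swap)
  then have "lower a0 \<le> a1"
    using mono_onD[OF lower_mono ends(1) x(1)] lower_eq_left_iff[OF x(1)] by simp
  then have "lower a0 = a1" using lower_bounds(1)[OF ends(1)] by simp
  then show "0 \<le> xi f g a0 a1" using lower_eq_left_iff[OF ends(1)] by simp
  show "xi f g b0 a1 < 0"
  proof (rule ccontr)
    assume "\<not> ?thesis"
    then have b0: "lower b0 = a1" using lower_eq_left_iff[OF ends(2)] by simp
    obtain z where z: "z \<in> {a0..b0}" "0 < xi f g z b1"
      using swap.xi_pos_somewhere[OF ends(4)] by (metis xi_swap)
    have "lower z \<le> a1" using mono_onD[OF lower_mono z(1) ends(2)] z(1) b0 by simp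
    then have "lower z = a1" using lower_bounds(1)[OF z(1)] by simp
    then show False using lower_eq_left_iff[OF z(1)] z not_full_section by force
  qed
qed

lemma is_x_m_iff: "is_x_m f g a0 b0 a1 b1 x \<longleftrightarrow> x \<in> {a0<..<b0} \<and> xi f g x a1 = 0"
  using lower_eq_left_iff[of x] by (auto simp: is_x_m_def)

text \<open>The function \<open>xi f g x a1\<close> of \<open>x\<close> is concave, nonnegative at \<^term>\<open>a0\<close> and somewhere positive, so it
  can vanish in the interior only while changing sign from plus to minus.\<close>

lemma sign_around_x_m:
  assumes z: "is_x_m f g a0 b0 a1 b1 z" and x: "x \<in> {a0..b0}"
  shows "0 \<le> xi f g x a1 \<longleftrightarrow> x \<le> z"
proof -
  have z': "a0 < z" "z < b0" "xi f g z a1 = 0" using z by (auto simp: is_x_m_iff)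
  note pos = concave_on_pos_between[OF concave_xi_fst, of _ _ a1 z]
  obtain p where p: "p \<in> {a0..b0}" "0 < xi f g p a1"
    using swap.xi_pos_somewhere[of a1] nondegenerate by (auto simp: xi_swap)
  \<comment> \<open>Between \<open>a0\<close>, where the function is nonnegative, and \<open>p\<close> it is positive.\<close>
  have pz: "p < z"
  proof (rule ccontr)
    assume "\<not> p < z"
    then have "z \<in> closed_segment a0 p" using z' by (auto simp: closed_segment_eq_real_ivl)
    then show False using pos[of a0 p] lower_corner_signs(1) p z' by simp
  qed
  show ?thesis
  proof
    assume nonneg: "0 \<le> xi f g x a1"
    show "x \<le> z"
    proof (rule ccontr)
      assume "\<not> x \<le> z"
      then have "z \<in> closed_segment x p" using pz by (auto simp: closed_segment_eq_real_ivl)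
      then show False using pos[of x p] x p nonneg z' \<open>\<not> x \<le> z\<close> by simp
    qed
  next
    assume "x \<le> z"
    show "0 \<le> xi f g x a1"
    proof (cases "x = z \<or> x = a0")
      case True
      then show ?thesis using z' lower_corner_signs(1) by auto
    next
      case False
      show ?thesis
      proof (cases "x \<le> p")
        case True
        then have "x \<in> closed_segment a0 p" using x by (auto simp: closed_segment_eq_real_ivl)
        then show ?thesis
          using concave_on_pos_between[OF concave_xi_fst, of a0 p a1 x]
            lower_corner_signs(1) p False x by auto
      next
        case False
        then have "x \<in> closed_segment z p" using \<open>x \<le> z\<close> by (auto simp: closed_segment_eq_real_ivl)
        then show ?thesis
          using concave_on_pos_between[OF concave_xi_fst, of z p a1 x] z' p
            \<open>\<not> (x = z \<or> x = a0)\<close> by auto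
      qed
    qed
  qed
qed

lemma ex1_x_m: "\<exists>!x. is_x_m f g a0 b0 a1 b1 x"
proof -
  obtain p where p: "p \<in> {a0..b0}" "0 < xi f g p a1"
    using swap.xi_pos_somewhere[of a1] nondegenerate by (auto simp: xi_swap)
  have "p \<le> b0" using p by simp
  then obtain z where z: "p \<le> z" "z \<le> b0" "xi f g z a1 = 0"
    using IVT2'[of "\<lambda>x. xi f g x a1" b0 0 p] lower_corner_signs(2) p
      continuous_on_subset[OF cont_xi_fst[of a1], of "{p..b0}"] by auto
  have "z \<noteq> p" "z \<noteq> b0" using z(3) p lower_corner_signs(2) by auto
  then have "is_x_m f g a0 b0 a1 b1 z" using z p by (simp add: is_x_m_iff)
  moreover have "z1 = z2" if "is_x_m f g a0 b0 a1 b1 z1" "is_x_m f g a0 b0 a1 b1 z2" for z1 z2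
    using sign_around_x_m[OF that(1), of z2] sign_around_x_m[OF that(2), of z1] that
    by (auto simp: is_x_m_iff)
  ultimately show ?thesis by blast
qed

lemma lower_left_of_x_m:
  assumes "is_x_m f g a0 b0 a1 b1 z" "x \<in> {a0..z}"
  shows "lower x = a1"
proof -
  have "x \<in> {a0..b0}" using assms by (auto simp: is_x_m_iff)
  then show ?thesis using sign_around_x_m[OF assms(1), of x] lower_eq_left_iff[of x] assms(2) by simp
qed

lemma lower_right_of_x_m:
  assumes "is_x_m f g a0 b0 a1 b1 z" "x \<in> {z<..b0}"
  shows "x \<in> {a0..b0}" "a1 < lower x"
proof -
  show x: "x \<in> {a0..b0}" using assms by (auto simp: is_x_m_iff)
  show "a1 < lower x"
    using sign_around_x_m[OF assms(1) x] lower_eq_left_iff[OF x] assms(2) lower_bounds(1)[OF x]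
    by force
qed

lemma lower_strict_mono_right_of_x_m:
  assumes "is_x_m f g a0 b0 a1 b1 z"
  shows "strict_mono_on {z<..b0} lower"
  by (rule strict_mono_onI) (use lower_strict lower_right_of_x_m[OF assms] in blast)

end

lemma (in dual_pair) partial_sectionsI:
  assumes "(SUP x\<in>{a0..b0}. measure lborel (section_at f g {a1..b1} x)) < measure lborel {a1..b1}"
  shows "partial_sections \<mu>0 \<mu>1 a0 b0 a1 b1 \<epsilon> f g"
proof unfold_locales
  fix x assume x: "x \<in> {a0..b0}"
  have "measure lborel (section_at f g {a1..b1} z) \<le> measure lborel {a1..b1}" if "z \<in> {a0..b0}" for z
  proof (rule measure_mono_fmeasurable)
    show "section_at f g {a1..b1} z \<subseteq> {a1..b1}" by (auto simp: section_at_def)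
    show "section_at f g {a1..b1} z \<in> sets lborel" using borel_closed[OF section_closed] by simp
    show "{a1..b1} \<in> fmeasurable lborel" by (rule fmeasurableI) (auto simp: emeasure_lborel_Icc_eq)
  qed
  then have "bdd_above ((\<lambda>z. measure lborel (section_at f g {a1..b1} z)) ` {a0..b0})"
    by (intro bdd_aboveI2)
  from cSUP_upper[OF x this] assms
  have lt: "measure lborel (section_at f g {a1..b1} x) < measure lborel {a1..b1}"
    by (rule le_less_trans)
  show "\<not> (0 \<le> xi f g x a1 \<and> 0 \<le> xi f g x b1)"
  proof
    assume "0 \<le> xi f g x a1 \<and> 0 \<le> xi f g x b1"
    then have "{a1..b1} \<subseteq> section_at f g {a1..b1} x"
      using section_contains_between[of a1 b1 x] nondegenerate by auto
    then have "section_at f g {a1..b1} x = {a1..b1}" by (auto simp: section_at_def)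
    then show False using lt by simp
  qed
qed

section \<open>Reflection, and the upper endpoint\<close>

text \<open>The transformation \<open>(x, y) \<mapsto> (- x, - y)\<close> preserves the product \<open>x * y\<close> and reverses both
  orders. It exchanges lower and upper endpoints of the sections and carries every statement
  about the former over to the latter.\<close>

lemma xi_reflect: "xi (\<lambda>x. f (- x)) (\<lambda>y. g (- y)) x y = xi f g (- x) (- y)"
  by (simp add: xi_def)

lemma section_at_reflect:
  "section_at (\<lambda>x. f (- x)) (\<lambda>y. g (- y)) {- b..- a} x = uminus ` section_at f g {a..b} (- x)"
proof (intro set_eqI iffI)
  fix y assume "y \<in> section_at (\<lambda>x. f (- x)) (\<lambda>y. g (- y)) {- b..- a} x"
  then have "- y \<in> section_at f g {a..b} (- x)" by (auto simp: section_at_def xi_reflect)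
  then show "y \<in> uminus ` section_at f g {a..b} (- x)" by force
qed (auto simp: section_at_def xi_reflect)

lemma y_m_reflect:
  "y_m (\<lambda>x. f (- x)) (\<lambda>y. g (- y)) {- b..- a} x = - y_M f g {a..b} (- x)"
  unfolding y_m_def y_M_def section_at_reflect Inf_real_def by (simp add: image_image)

lemma is_x_m_reflect:
  "is_x_m (\<lambda>x. f (- x)) (\<lambda>y. g (- y)) (- b0) (- a0) (- b1) (- a1) x \<longleftrightarrow>
   is_x_M f g a0 b0 a1 b1 (- x)"
  by (auto simp: is_x_m_def is_x_M_def y_m_reflect xi_reflect)

lemma has_real_derivative_reflect:
  fixes h :: "real \<Rightarrow> real"
  assumes "((\<lambda>x. h (- x)) has_real_derivative D) (at (- x) within {- b..- a})"
  shows "(h has_real_derivative - D) (at x within {a..b})"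
proof -
  have "((\<lambda>x. h (- x)) has_real_derivative D) (at (uminus x) within uminus ` {a..b})"
    using assms by simp
  from DERIV_image_chain[OF this, of "-1"] show ?thesis
    by (simp add: comp_def DERIV_ident[THEN DERIV_minus])
qed

lemma full_interval_measure_reflect:
  assumes "full_interval_measure \<mu> a b"
  shows "full_interval_measure (distr \<mu> borel uminus) (- b) (- a)"
proof -
  interpret full_interval_measure \<mu> a b by fact
  have meas: "(uminus :: real \<Rightarrow> real) \<in> measurable \<mu> borel" by measurable
  interpret D: finite_measure "distr \<mu> borel uminus"
    by (rule finite_measure_distr[OF meas])
  have sp: "space \<mu> = UNIV" using sets_eq_imp_space_eq[OF sets_eq] by simp
  show ?thesis
  proof
    show "emeasure (distr \<mu> borel uminus) {y} = 0" for y :: real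
    proof -
      have "(uminus -` {y}) = {- y}" by auto
      then show ?thesis using atomless[of "- y"] by (simp add: emeasure_distr[OF meas] sp)
    qed
    show "0 < measure (distr \<mu> borel uminus) {c<..<d}" if "- b \<le> c" "c < d" "d \<le> - a" for c d
    proof -
      have "(uminus -` {c<..<d}) = {- d<..<- c}" by auto
      then show ?thesis using full[of "- d" "- c"] that by (simp add: measure_distr[OF meas] sp)
    qed
  qed (use nondegenerate in auto)
qed

lemma marginal_constraint_reflect:
  assumes "marginal_constraint \<mu> a1 b1 a0 b0 \<epsilon> f g"
  shows "marginal_constraint (distr \<mu> borel uminus) (- b1) (- a1) (- b0) (- a0) \<epsilon>
    (\<lambda>x. f (- x)) (\<lambda>y. g (- y))"
proof -
  interpret marginal_constraint \<mu> a1 b1 a0 b0 \<epsilon> f g by fact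
  interpret D: full_interval_measure "distr \<mu> borel uminus" "- b1" "- a1"
    by (rule full_interval_measure_reflect) unfold_locales
  have cont: "continuous_on {- d..- c} (\<lambda>x. h (- x))" if "continuous_on {c..d} h" for c d and h :: "real \<Rightarrow> real"
    by (rule continuous_on_compose2[OF that]) (auto intro: continuous_intros)
  show ?thesis
  proof
    fix x assume x: "x \<in> {- b0..- a0}"
    have meas: "(\<lambda>y. indicat_real {- b1..- a1} y *\<^sub>R max (xi f g (- x) (- y)) 0) \<in> borel_measurable borel"
      by (intro borel_measurable_continuous_on_indicator continuous_intros cont[OF cont_xi_snd]) auto
    have "(LINT y:{- b1..- a1}|distr \<mu> borel uminus. max (xi (\<lambda>x. f (- x)) (\<lambda>y. g (- y)) x y) 0)
      = (LINT y:{a1..b1}|\<mu>. max (xi f g (- x) y) 0)"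
      unfolding set_lebesgue_integral_def xi_reflect
      by (subst integral_distr[OF _ meas]) (auto simp: indicator_def intro!: Bochner_Integration.integral_cong)
    also have "\<dots> = \<epsilon>" using constraint[of "- x"] x by simp
    finally show "(LINT y:{- b1..- a1}|distr \<mu> borel uminus. max (xi (\<lambda>x. f (- x)) (\<lambda>y. g (- y)) x y) 0) = \<epsilon>" .
  qed (use domain_nondegenerate \<epsilon>_pos cont[OF cont_f] cont[OF cont_g] in auto)
qed

lemma (in partial_sections) partial_sections_reflect:
  "partial_sections (distr \<mu>0 borel uminus) (distr \<mu>1 borel uminus) (- b0) (- a0) (- b1) (- a1) \<epsilon>
    (\<lambda>x. f (- x)) (\<lambda>y. g (- y))"
proof -
  interpret R0: marginal_constraint "distr \<mu>1 borel uminus" "- b1" "- a1" "- b0" "- a0" \<epsilon>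
    "\<lambda>x. f (- x)" "\<lambda>y. g (- y)"
    by (rule marginal_constraint_reflect) unfold_locales
  interpret R1: marginal_constraint "distr \<mu>0 borel uminus" "- b0" "- a0" "- b1" "- a1" \<epsilon>
    "\<lambda>y. g (- y)" "\<lambda>x. f (- x)"
    by (rule marginal_constraint_reflect) unfold_locales
  show ?thesis
    by unfold_locales (use not_full_section in \<open>auto simp: xi_reflect\<close>)
qed

context partial_sections
begin

abbreviation upper :: "real \<Rightarrow> real" where
  "upper \<equiv> y_M f g {a1..b1}"

interpretation R: partial_sections "distr \<mu>0 borel uminus" "distr \<mu>1 borel uminus"
    "- b0" "- a0" "- b1" "- a1" \<epsilon> "\<lambda>x. f (- x)" "\<lambda>y. g (- y)"
  by (rule partial_sections_reflect)

lemma upper_eq: "upper x = - R.lower (- x)"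
  by (simp add: y_m_reflect)

lemma upper_mono: "mono_on {a0..b0} upper"
  by (rule mono_onI) (use R.lower_mono in \<open>force simp: upper_eq mono_on_def\<close>)

lemma ex1_x_M: "\<exists>!x. is_x_M f g a0 b0 a1 b1 x"
  using R.ex1_x_m unfolding is_x_m_reflect by (metis minus_minus)

lemma upper_right_of_x_M:
  assumes "is_x_M f g a0 b0 a1 b1 z" "x \<in> {z..b0}"
  shows "upper x = b1"
  using R.lower_left_of_x_m[of "- z" "- x"] assms by (simp add: is_x_m_reflect upper_eq)

lemma upper_strict_mono_left_of_x_M:
  assumes "is_x_M f g a0 b0 a1 b1 z"
  shows "strict_mono_on {a0..<z} upper"
  using R.lower_strict_mono_right_of_x_m[of "- z"] assms
  by (force simp: is_x_m_reflect upper_eq strict_mono_on_def)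

text \<open>The reflection reverses the signs of both \<open>f'\<close> and \<open>g'\<close>, and the quotient in the formula does
  not change.\<close>

lemma upper_has_derivative:
  assumes z: "is_x_M f g a0 b0 a1 b1 z" and x: "x \<in> {a0..<z}"
  shows "\<exists>f' g'. (f has_real_derivative f') (at x within {a0..b0}) \<and>
    (g has_real_derivative g') (at (upper x) within {a1..b1}) \<and> x - g' \<noteq> 0 \<and>
    (upper has_real_derivative - ((upper x - f') / (x - g'))) (at x within {a0..b0}) \<and>
    0 < - ((upper x - f') / (x - g'))"
proof -
  have "- x \<in> {- b0..- a0}" "- b1 < R.lower (- x)"
    using R.lower_right_of_x_m[of "- z" "- x"] z x by (simp_all add: is_x_m_reflect)
  from R.lower_has_derivative[OF this] obtain f' g' where
    f': "((\<lambda>x. f (- x)) has_real_derivative f') (at (- x) within {- b0..- a0})" and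
    g': "((\<lambda>y. g (- y)) has_real_derivative g') (at (- upper x) within {- b1..- a1})" and
    ne: "- x - g' \<noteq> 0" and
    R: "(R.lower has_real_derivative - ((- upper x - f') / (- x - g'))) (at (- x) within {- b0..- a0})" and
    pos: "0 < - ((- upper x - f') / (- x - g'))"
    unfolding upper_eq by auto
  have neg: "- upper x - f' = - (upper x - (- f'))" "- x - g' = - (x - (- g'))"
    by simp_all
  have quot: "(- upper x - f') / (- x - g') = (upper x - (- f')) / (x - (- g'))"
    unfolding neg by (rule minus_divide_divide)
  have "((\<lambda>x. - upper (- x)) has_real_derivative - ((- upper x - f') / (- x - g')))
      (at (- x) within {- b0..- a0})"
    using R by (simp add: y_m_reflect[abs_def])
  then have "((\<lambda>x. upper (- x)) has_real_derivative - (- ((- upper x - f') / (- x - g'))))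
      (at (- x) within {- b0..- a0})"
    using DERIV_minus by fastforce
  then have "(upper has_real_derivative - ((- upper x - f') / (- x - g'))) (at x within {a0..b0})"
    using has_real_derivative_reflect[of upper] by fastforce
  then show ?thesis
    using has_real_derivative_reflect[OF f'] has_real_derivative_reflect[OF g'] ne pos
    unfolding quot by (intro exI[of _ "- f'"] exI[of _ "- g'"]) auto
qed

end

section \<open>From the optimal plan to the marginal constraints\<close>

lemma borel_measurable_density_Icc:
  fixes u :: "real \<Rightarrow> real"
  assumes "continuous_on {a..b} u"
  shows "(\<lambda>x. ennreal (u x) * indicator {a..b} x) \<in> borel_measurable lborel"
proof -
  have "(\<lambda>x. ennreal (indicat_real {a..b} x *\<^sub>R u x)) \<in> borel_measurable borel"
    by (intro measurable_compose[OF borel_measurable_continuous_on_indicator[OF _ assms]] measurable_ennreal) auto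
  also have "(\<lambda>x. ennreal (indicat_real {a..b} x *\<^sub>R u x)) = (\<lambda>x. ennreal (u x) * indicator {a..b} x)"
    by (auto simp: indicator_def)
  finally show ?thesis by simp
qed

text \<open>The interval is nondegenerate because a probability density cannot live on a null set.\<close>

lemma full_interval_measure_of_density:
  assumes "0 < l" and m: "marginal_with_density a b u l L \<mu>"
  shows "full_interval_measure \<mu> a b"
proof -
  have prob: "prob_space \<mu>"
    and \<mu>: "\<mu> = density lborel (\<lambda>x. ennreal (u x) * indicator {a..b} x)"
    and u: "continuous_on {a..b} u" "\<And>x. x \<in> {a..b} \<Longrightarrow> l \<le> u x"
    using m by (auto simp: marginal_with_density_def)
  interpret prob_space \<mu> by fact
  note meas = borel_measurable_density_Icc[OF u(1)]
  have em: "emeasure \<mu> A = (\<integral>\<^sup>+x. ennreal (u x) * indicator {a..b} x * indicator A x \<partial>lborel)"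
    if "A \<in> sets borel" for A
    unfolding \<mu> using that by (subst emeasure_density[OF meas]) auto
  have null: "emeasure \<mu> A = 0" if "A \<in> sets borel" "emeasure lborel A = 0" for A
  proof -
    have "A \<in> null_sets lborel" using that by auto
    moreover have "absolutely_continuous lborel \<mu>"
      unfolding \<mu> by (rule absolutely_continuousI_density[OF meas])
    ultimately show ?thesis by (auto simp: absolutely_continuous_def)
  qed
  show ?thesis
  proof
    show "sets \<mu> = sets borel" by (simp add: \<mu>)
    show "emeasure \<mu> {y} = 0" for y by (rule null) auto
    show "a < b"
    proof (rule ccontr)
      assume "\<not> a < b"
      then have "emeasure lborel {a..b} = 0" by (simp add: emeasure_lborel_Icc_eq)
      have "AE x in \<mu>. x \<notin> {a..b}"
        using null[OF _ \<open>emeasure lborel {a..b} = 0\<close>]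
        by (intro AE_not_in) (auto simp: null_sets_def \<mu>)
      moreover have "AE x in \<mu>. x \<in> {a..b}"
        unfolding \<mu> by (subst AE_density[OF meas]) (auto simp: indicator_def)
      ultimately have "AE x in \<mu>. False" by eventually_elim simp
      then show False by simp
    qed
    show "0 < measure \<mu> {c<..<d}" if cd: "a \<le> c" "c < d" "d \<le> b" for c d
    proof -
      have "0 < ennreal (l * (d - c))" using \<open>0 < l\<close> cd by simp
      also have "ennreal (l * (d - c)) = (\<integral>\<^sup>+x. ennreal l * indicator {c<..<d} x \<partial>lborel)"
        using \<open>0 < l\<close> cd by (subst nn_integral_cmult_indicator) (auto simp: ennreal_mult)
      also have "\<dots> \<le> emeasure \<mu> {c<..<d}"
        using u(2) cd by (subst em) (auto intro!: nn_integral_mono ennreal_leI simp: indicator_def)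
      finally show ?thesis by (simp add: emeasure_eq_measure)
    qed
  qed
qed

lemma AE_marginal_with_density:
  assumes "marginal_with_density a b u l L \<mu>"
  shows "AE x in \<mu>. x \<in> {a..b}"
proof -
  have u: "continuous_on {a..b} u"
    and \<mu>: "\<mu> = density lborel (\<lambda>x. ennreal (u x) * indicator {a..b} x)"
    using assms by (auto simp: marginal_with_density_def)
  note meas = borel_measurable_density_Icc[OF u(1)]
  show ?thesis unfolding \<mu> by (subst AE_density[OF meas]) (auto simp: indicator_def)
qed

text \<open>Fubini shows that the partial integral of the density is itself a density of the marginal
  with respect to itself, and such a density is almost everywhere 1.\<close>

lemma coupling_density_marginals:
  fixes K :: "'a \<times> 'b \<Rightarrow> ennreal"
  assumes "prob_space M0" "prob_space M1"
    and K: "K \<in> borel_measurable (M0 \<Otimes>\<^sub>M M1)"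
    and fst: "distr (density (M0 \<Otimes>\<^sub>M M1) K) M0 fst = M0"
    and snd: "distr (density (M0 \<Otimes>\<^sub>M M1) K) M1 snd = M1"
  shows "AE x in M0. (\<integral>\<^sup>+y. K (x, y) \<partial>M1) = 1" "AE y in M1. (\<integral>\<^sup>+x. K (x, y) \<partial>M0) = 1"
proof -
  interpret M0: prob_space M0 by fact
  interpret M1: prob_space M1 by fact
  interpret pair_sigma_finite M0 M1 ..
  note [measurable] = K
  have "density M0 (\<lambda>x. \<integral>\<^sup>+y. K (x, y) \<partial>M1) = M0"
  proof (rule measure_eqI)
    fix A assume "A \<in> sets (density M0 (\<lambda>x. \<integral>\<^sup>+y. K (x, y) \<partial>M1))"
    then have A[measurable]: "A \<in> sets M0" by simp
    have "emeasure M0 A = emeasure (distr (density (M0 \<Otimes>\<^sub>M M1) K) M0 fst) A"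
      by (simp only: fst)
    also have "\<dots> = (\<integral>\<^sup>+z. K z * indicator (fst -` A \<inter> space (M0 \<Otimes>\<^sub>M M1)) z \<partial>(M0 \<Otimes>\<^sub>M M1))"
      by (subst emeasure_distr) (auto simp: emeasure_density)
    also have "\<dots> = (\<integral>\<^sup>+z. K z * indicator A (fst z) \<partial>(M0 \<Otimes>\<^sub>M M1))"
      by (intro nn_integral_cong) (auto simp: indicator_def)
    also have "\<dots> = (\<integral>\<^sup>+x. \<integral>\<^sup>+y. K (x, y) * indicator A x \<partial>M1 \<partial>M0)"
      by (subst M1.nn_integral_fst[symmetric]) auto
    also have "\<dots> = (\<integral>\<^sup>+x. (\<integral>\<^sup>+y. K (x, y) \<partial>M1) * indicator A x \<partial>M0)"
      by (intro nn_integral_cong nn_integral_multc) auto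
    finally show "emeasure (density M0 (\<lambda>x. \<integral>\<^sup>+y. K (x, y) \<partial>M1)) A = emeasure M0 A"
      by (simp add: emeasure_density)
  qed simp
  then show "AE x in M0. (\<integral>\<^sup>+y. K (x, y) \<partial>M1) = 1"
    by (intro M0.density_unique) (auto simp: density_1)
  have "density M1 (\<lambda>y. \<integral>\<^sup>+x. K (x, y) \<partial>M0) = M1"
  proof (rule measure_eqI)
    fix A assume "A \<in> sets (density M1 (\<lambda>y. \<integral>\<^sup>+x. K (x, y) \<partial>M0))"
    then have A[measurable]: "A \<in> sets M1" by simp
    have "emeasure M1 A = emeasure (distr (density (M0 \<Otimes>\<^sub>M M1) K) M1 snd) A"
      by (simp only: snd)
    also have "\<dots> = (\<integral>\<^sup>+z. K z * indicator (snd -` A \<inter> space (M0 \<Otimes>\<^sub>M M1)) z \<partial>(M0 \<Otimes>\<^sub>M M1))"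
      by (subst emeasure_distr) (auto simp: emeasure_density)
    also have "\<dots> = (\<integral>\<^sup>+z. K z * indicator A (snd z) \<partial>(M0 \<Otimes>\<^sub>M M1))"
      by (intro nn_integral_cong) (auto simp: indicator_def)
    also have "\<dots> = (\<integral>\<^sup>+y. \<integral>\<^sup>+x. K (x, y) * indicator A y \<partial>M0 \<partial>M1)"
      by (subst nn_integral_snd[symmetric]) auto
    also have "\<dots> = (\<integral>\<^sup>+y. (\<integral>\<^sup>+x. K (x, y) \<partial>M0) * indicator A y \<partial>M1)"
      by (intro nn_integral_cong nn_integral_multc) auto
    finally show "emeasure (density M1 (\<lambda>y. \<integral>\<^sup>+x. K (x, y) \<partial>M0)) A = emeasure M1 A"
      by (simp add: emeasure_density)
  qed simp
  then show "AE y in M1. (\<integral>\<^sup>+x. K (x, y) \<partial>M0) = 1"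
    by (intro M1.density_unique) (auto simp: density_1)
qed

context full_interval_measure
begin

lemma nn_integral_continuous_Icc:
  fixes h :: "real \<Rightarrow> real"
  assumes "continuous_on {a..b} h" and "\<And>y. y \<in> {a..b} \<Longrightarrow> 0 \<le> h y"
  shows "(\<integral>\<^sup>+y. ennreal (indicat_real {a..b} y * h y) \<partial>\<mu>) = ennreal (LINT y:{a..b}|\<mu>. h y)"
  using set_integrable_continuous[OF assms(1)] assms(2)
  unfolding set_lebesgue_integral_def set_integrable_def
  by (subst nn_integral_eq_integral) (auto simp: indicator_def)

lemma continuous_on_set_integral_parameter:
  fixes k :: "real \<times> real \<Rightarrow> real"
  assumes "compact A" and k: "continuous_on (A \<times> {a..b}) k"
  shows "continuous_on A (\<lambda>x. LINT y:{a..b}|\<mu>. k (x, y))"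
proof (rule continuous_on_sequentiallyI)
  fix u x assume u: "\<forall>n. u n \<in> A" and x: "x \<in> A" and ux: "u \<longlonglongrightarrow> x"
  have "bounded (k ` (A \<times> {a..b}))"
    using assms by (intro compact_imp_bounded compact_continuous_image compact_Times) auto
  then obtain B where B: "\<And>z. z \<in> A \<times> {a..b} \<Longrightarrow> norm (k z) \<le> B"
    unfolding bounded_iff by blast
  have B': "\<bar>k (z, y)\<bar> \<le> B" if "z \<in> A" "a \<le> y" "y \<le> b" for z y
    using B[of "(z, y)"] that by simp
  have "norm (k (x, a)) \<le> B" using x nondegenerate by (intro B) auto
  then have "0 \<le> B" by (metis norm_ge_zero order_trans)
  have cont: "continuous_on {a..b} (\<lambda>y. k (z, y))" if "z \<in> A" for z
    by (rule continuous_on_compose2[OF k]) (use that in \<open>auto intro!: continuous_intros\<close>)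
  have meas: "(\<lambda>y. indicat_real {a..b} y *\<^sub>R k (z, y)) \<in> borel_measurable \<mu>" if "z \<in> A" for z
    using set_integrable_continuous[OF cont[OF that]] by (auto simp: set_integrable_def)
  show "(\<lambda>n. LINT y:{a..b}|\<mu>. k (u n, y)) \<longlonglongrightarrow> (LINT y:{a..b}|\<mu>. k (x, y))"
    unfolding set_lebesgue_integral_def
  proof (rule integral_dominated_convergence[where w = "\<lambda>_. B"])
    show "AE y in \<mu>. norm (indicat_real {a..b} y *\<^sub>R k (u n, y)) \<le> B" for n
      using B' u \<open>0 \<le> B\<close> by (auto simp: indicator_def)
    show "AE y in \<mu>. (\<lambda>n. indicat_real {a..b} y *\<^sub>R k (u n, y)) \<longlonglongrightarrow> indicat_real {a..b} y *\<^sub>R k (x, y)"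
    proof (rule AE_I2)
      fix y
      show "(\<lambda>n. indicat_real {a..b} y *\<^sub>R k (u n, y)) \<longlonglongrightarrow> indicat_real {a..b} y *\<^sub>R k (x, y)"
      proof (cases "y \<in> {a..b}")
        case True
        have "(\<lambda>n. k (u n, y)) \<longlonglongrightarrow> k (x, y)"
          by (rule continuous_on_tendsto_compose[OF k])
            (use True u x ux in \<open>auto intro!: tendsto_intros\<close>)
        then show ?thesis by (intro tendsto_intros)
      qed simp
    qed
  qed (use meas u x in auto)
qed

end

lemma continuous_on_xi:
  assumes "continuous_on {a0..b0} f" "continuous_on {a1..b1} g"
  shows "continuous_on ({a0..b0} \<times> {a1..b1}) (\<lambda>z. xi f g (fst z) (snd z))"
  unfolding xi_def
  by (intro continuous_intros continuous_on_compose2[OF assms(1)] continuous_on_compose2[OF assms(2)]) auto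

text \<open>The marginal equation holds almost everywhere for the coupling. Both sides are continuous and
  the first marginal charges every interval, so it holds at every point.\<close>

lemma marginal_constraintI:
  assumes "full_interval_measure \<mu>0 a0 b0" "full_interval_measure \<mu>1 a1 b1"
    and "0 < \<epsilon>" and f: "continuous_on {a0..b0} f" and g: "continuous_on {a1..b1} g"
    and ae: "AE x in \<mu>0. x \<in> {a0..b0} \<longrightarrow>
      (\<integral>\<^sup>+y. ennreal (indicat_real {a1..b1} y * max (xi f g x y / \<epsilon>) 0) \<partial>\<mu>1) = 1"
  shows "marginal_constraint \<mu>1 a1 b1 a0 b0 \<epsilon> f g"
proof -
  interpret M0: full_interval_measure \<mu>0 a0 b0 by fact
  interpret M1: full_interval_measure \<mu>1 a1 b1 by fact
  show ?thesis
  proof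
    fix x assume x: "x \<in> {a0..b0}"
    have H: "(LINT y:{a1..b1}|\<mu>1. max (xi f g x y / \<epsilon>) 0) = (LINT y:{a1..b1}|\<mu>1. max (xi f g x y) 0) / \<epsilon>" for x
    proof -
      have "max (xi f g x y / \<epsilon>) 0 = max (xi f g x y) 0 / \<epsilon>" for y
        using \<open>0 < \<epsilon>\<close> by (auto simp: max_def divide_le_0_iff zero_le_divide_iff)
      then show ?thesis by simp
    qed
    have "AE x in \<mu>0. x \<in> {a0..b0} \<longrightarrow> (LINT y:{a1..b1}|\<mu>1. max (xi f g x y / \<epsilon>) 0) = 1"
      using ae
    proof eventually_elim
      case (elim x)
      have "continuous_on {a1..b1} (\<lambda>y. max (xi f g x y / \<epsilon>) 0)"
        unfolding xi_def using \<open>0 < \<epsilon>\<close> by (intro continuous_intros g) auto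
      then show ?case
        using elim by (subst (asm) M1.nn_integral_continuous_Icc) auto
    qed
    moreover have "continuous_on {a0..b0} (\<lambda>x. LINT y:{a1..b1}|\<mu>1. max (xi f g x y / \<epsilon>) 0)"
      using M1.continuous_on_set_integral_parameter[of "{a0..b0}"
          "\<lambda>z. max (xi f g (fst z) (snd z) / \<epsilon>) 0"] \<open>0 < \<epsilon>\<close>
      by (simp add: continuous_on_max continuous_on_divide continuous_on_xi[OF f g])
    ultimately have "(LINT y:{a1..b1}|\<mu>1. max (xi f g x y / \<epsilon>) 0) = 1"
      using M0.AE_continuous_imp_everywhere x by blast
    then show "(LINT y:{a1..b1}|\<mu>1. max (xi f g x y) 0) = \<epsilon>"
      using H[of x] \<open>0 < \<epsilon>\<close> by simp
  qed (use M0.nondegenerate \<open>0 < \<epsilon>\<close> f g in auto)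
qed

text \<open>The potentials express the density of the plan in terms of \<^term>\<open>xi f g\<close>, and the coupling
  condition says that its partial integrals are 1 almost everywhere.\<close>

lemma dual_pair_of_potentials:
  assumes "0 < l"
    and m0: "marginal_with_density a0 b0 u0 l L \<mu>0"
    and m1: "marginal_with_density a1 b1 u1 l L \<mu>1"
    and "0 < \<epsilon>"
    and \<pi>: "\<pi> \<in> couplings \<mu>0 \<mu>1"
    and pot: "qot_potentials \<epsilon> {a0..b0} {a1..b1} \<mu>0 \<mu>1 \<pi> f g"
  shows "dual_pair \<mu>0 \<mu>1 a0 b0 a1 b1 \<epsilon> f g"
proof -
  note full = full_interval_measure_of_density[OF \<open>0 < l\<close> m0] full_interval_measure_of_density[OF \<open>0 < l\<close> m1]
  interpret F0: full_interval_measure \<mu>0 a0 b0 by (fact full)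
  interpret F1: full_interval_measure \<mu>1 a1 b1 by (fact full)
  have prob: "prob_space \<mu>0" "prob_space \<mu>1" using m0 m1 by (auto simp: marginal_with_density_def)
  interpret P0: prob_space \<mu>0 by fact
  interpret P1: prob_space \<mu>1 by fact
  interpret pair_prob_space \<mu>0 \<mu>1 ..
  have f: "continuous_on {a0..b0} f" and g: "continuous_on {a1..b1} g"
    and ac: "absolutely_continuous (\<mu>0 \<Otimes>\<^sub>M \<mu>1) \<pi>"
    and RN: "AE z in \<mu>0 \<Otimes>\<^sub>M \<mu>1. RN_deriv (\<mu>0 \<Otimes>\<^sub>M \<mu>1) \<pi> z = ennreal (max (xi f g (fst z) (snd z) / \<epsilon>) 0)"
    using pot by (auto simp: qot_potentials_def)
  have sets: "sets (\<mu>0 \<Otimes>\<^sub>M \<mu>1) = sets borel"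
    unfolding borel_prod[symmetric] by (rule sets_pair_measure_cong) auto
  let ?box = "{a0..b0} \<times> {a1..b1}"
  \<comment> \<open>Outside the box the potentials are arbitrary, possibly not measurable, so the density is
    cut off before Fubini's theorem is applied.\<close>
  define K where "K z = ennreal (indicat_real ?box z * max (xi f g (fst z) (snd z) / \<epsilon>) 0)" for z
  have box: "?box \<in> sets borel" by (intro borel_closed closed_Times) auto
  have "(\<lambda>z. indicat_real ?box z *\<^sub>R max (xi f g (fst z) (snd z) / \<epsilon>) 0) \<in> borel_measurable borel"
    using \<open>0 < \<epsilon>\<close> by (intro borel_measurable_continuous_on_indicator box continuous_intros continuous_on_xi f g) auto
  then have K: "K \<in> borel_measurable (\<mu>0 \<Otimes>\<^sub>M \<mu>1)"
    unfolding K_def[abs_def] by (simp add: measurable_cong_sets[OF sets refl])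
  have "AE z in \<mu>0 \<Otimes>\<^sub>M \<mu>1. z \<in> ?box"
  proof (rule AE_pair_measure)
    show "{z \<in> space (\<mu>0 \<Otimes>\<^sub>M \<mu>1). z \<in> ?box} \<in> sets (\<mu>0 \<Otimes>\<^sub>M \<mu>1)"
      using box sets by (simp add: sets_eq_imp_space_eq[OF sets])
    show "AE x in \<mu>0. AE y in \<mu>1. (x, y) \<in> ?box"
      using AE_marginal_with_density[OF m0]
    proof eventually_elim
      case (elim x)
      show ?case using AE_marginal_with_density[OF m1] by eventually_elim (use elim in auto)
    qed
  qed
  with RN have "AE z in \<mu>0 \<Otimes>\<^sub>M \<mu>1. RN_deriv (\<mu>0 \<Otimes>\<^sub>M \<mu>1) \<pi> z = K z"
    by eventually_elim (auto simp: K_def)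
  then have "density (\<mu>0 \<Otimes>\<^sub>M \<mu>1) (RN_deriv (\<mu>0 \<Otimes>\<^sub>M \<mu>1) \<pi>) = density (\<mu>0 \<Otimes>\<^sub>M \<mu>1) K"
    by (intro density_cong K borel_measurable_RN_deriv)
  then have dens: "\<pi> = density (\<mu>0 \<Otimes>\<^sub>M \<mu>1) K"
    using density_RN_deriv[OF ac] \<pi> sets by (simp add: couplings_def)
  have "distr \<pi> \<mu>0 fst = distr \<pi> borel fst" "distr \<pi> \<mu>1 snd = distr \<pi> borel snd"
    by (auto intro!: distr_cong)
  then have "distr (density (\<mu>0 \<Otimes>\<^sub>M \<mu>1) K) \<mu>0 fst = \<mu>0" "distr (density (\<mu>0 \<Otimes>\<^sub>M \<mu>1) K) \<mu>1 snd = \<mu>1"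
    using \<pi> dens by (auto simp: couplings_def)
  note marg = coupling_density_marginals[OF prob K this]
  interpret A: marginal_constraint \<mu>1 a1 b1 a0 b0 \<epsilon> f g
  proof (rule marginal_constraintI[OF full \<open>0 < \<epsilon>\<close> f g])
    show "AE x in \<mu>0. x \<in> {a0..b0} \<longrightarrow>
      (\<integral>\<^sup>+y. ennreal (indicat_real {a1..b1} y * max (xi f g x y / \<epsilon>) 0) \<partial>\<mu>1) = 1"
      using marg(1) by eventually_elim (auto simp: K_def indicator_times)
  qed
  interpret B: marginal_constraint \<mu>0 a0 b0 a1 b1 \<epsilon> g f
  proof (rule marginal_constraintI[OF full(2,1) \<open>0 < \<epsilon>\<close> g f])
    show "AE y in \<mu>1. y \<in> {a1..b1} \<longrightarrow>
      (\<integral>\<^sup>+x. ennreal (indicat_real {a0..b0} x * max (xi g f y x / \<epsilon>) 0) \<partial>\<mu>0) = 1"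
      using marg(2)
    proof eventually_elim
      case (elim y)
      have "xi g f y x = xi f g x y" for x by (rule xi_swap)
      then show ?case using elim by (auto simp: K_def indicator_times)
    qed
  qed
  show ?thesis ..
qed
section \<open>Monotonicity of the sections\<close>

theorem proposition4p2:
  fixes a0 b0 a1 b1 l L \<epsilon> :: real
    and u0 u1 f g :: "real \<Rightarrow> real"
    and \<mu>0 \<mu>1 :: "real measure"
    and \<pi> :: "(real \<times> real) measure"
  assumes "0 < l"
    and "marginal_with_density a0 b0 u0 l L \<mu>0"
    and "marginal_with_density a1 b1 u1 l L \<mu>1"
    and "0 < \<epsilon>"
    and "qot_minimizer \<epsilon> \<mu>0 \<mu>1 \<pi>"
    and "qot_potentials \<epsilon> {a0..b0} {a1..b1} \<mu>0 \<mu>1 \<pi> f g"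
    and "(SUP x\<in>{a0..b0}. measure lborel (section_at f g {a1..b1} x))
           \<le> 1 / 3 * measure lborel {a1..b1}"
  shows
    "(\<exists>!x. is_x_M f g a0 b0 a1 b1 x) \<and>
     (\<exists>!x. is_x_m f g a0 b0 a1 b1 x) \<and>
     (\<forall>x\<in>{a0..b0}. section_at f g {a1..b1} x = {y_m f g {a1..b1} x..y_M f g {a1..b1} x}) \<and>
     mono_on {a0..b0} (y_m f g {a1..b1}) \<and>
     mono_on {a0..b0} (y_M f g {a1..b1}) \<and>
     (\<forall>xm. is_x_m f g a0 b0 a1 b1 xm \<longrightarrow>
        (\<forall>x\<in>{a0..xm}. y_m f g {a1..b1} x = a1) \<and>
        strict_mono_on {xm<..b0} (y_m f g {a1..b1}) \<and>
        (\<forall>x\<in>{xm<..b0}. \<exists>f' g'.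
           (f has_real_derivative f') (at x within {a0..b0}) \<and>
           (g has_real_derivative g') (at (y_m f g {a1..b1} x) within {a1..b1}) \<and>
           x - g' \<noteq> 0 \<and>
           (y_m f g {a1..b1} has_real_derivative - ((y_m f g {a1..b1} x - f') / (x - g')))
             (at x within {a0..b0}))) \<and>
     (\<forall>xM. is_x_M f g a0 b0 a1 b1 xM \<longrightarrow>
        (\<forall>x\<in>{xM..b0}. y_M f g {a1..b1} x = b1) \<and>
        strict_mono_on {a0..<xM} (y_M f g {a1..b1}) \<and>
        (\<forall>x\<in>{a0..<xM}. \<exists>f' g'.
           (f has_real_derivative f') (at x within {a0..b0}) \<and>
           (g has_real_derivative g') (at (y_M f g {a1..b1} x) within {a1..b1}) \<and>
           x - g' \<noteq> 0 \<and>
           (y_M f g {a1..b1} has_real_derivative - ((y_M f g {a1..b1} x - f') / (x - g')))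
             (at x within {a0..b0}) \<and>
           - ((y_M f g {a1..b1} x - f') / (x - g')) > 0))"
proof -
  interpret dual_pair \<mu>0 \<mu>1 a0 b0 a1 b1 \<epsilon> f g
    by (rule dual_pair_of_potentials[OF assms(1-4) _ assms(6)])
      (use assms(5) in \<open>simp add: qot_minimizer_def\<close>)
  have "0 < measure lborel {a1..b1}" using nondegenerate by simp
  then have "(SUP x\<in>{a0..b0}. measure lborel (section_at f g {a1..b1} x)) < measure lborel {a1..b1}"
    using assms(7) by linarith
  then interpret partial_sections \<mu>0 \<mu>1 a0 b0 a1 b1 \<epsilon> f g
    by (rule partial_sectionsI)
  have "\<exists>f' g'. (f has_real_derivative f') (at x within {a0..b0}) \<and>
      (g has_real_derivative g') (at (lower x) within {a1..b1}) \<and> x - g' \<noteq> 0 \<and>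
      (lower has_real_derivative - ((lower x - f') / (x - g'))) (at x within {a0..b0})"
    if "is_x_m f g a0 b0 a1 b1 xm" "x \<in> {xm<..b0}" for xm x
    using lower_has_derivative[OF lower_right_of_x_m[OF that]] by blast
  then show ?thesis
    using ex1_x_M ex1_x_m section_eq_Icc lower_mono upper_mono
      lower_left_of_x_m lower_strict_mono_right_of_x_m
      upper_right_of_x_M upper_strict_mono_left_of_x_M upper_has_derivative
    by (intro conjI allI impI ballI) blast+
qed

end
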